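(* Let $\mathbb{L}$ be a complete, algebraically closed non-Archimedean field of characteristic $0$, and let $\phi$ be a rational map of degree $\geq 2$ defined over $\mathbb{L}$ having good reduction. Then the fixed point locus $\{\zeta \in \mathbb{P}^1_{an} : \phi(\zeta)=\zeta\}$ of $\phi$ in the Berkovich projective line $\mathbb{P}^1_{an}$ over $\mathbb{L}$ is connected if and only if the reduction $\tilde\phi$ of $\phi$ has no fixed critical point in $\mathbb{P}^1(\tilde{\mathbb{L}})$.
   Context: $\mathcal{O}_{\mathbb{L}}=\{|x|\le 1\}$ is the valuation ring, $m_{\mathbb{L}}$ its maximal ideal and $\tilde{\mathbb{L}}=\mathcal{O}_{\mathbb{L}}/m_{\mathbb{L}}$ the residue field. A normalized form of $\phi$ is a representation $\phi=F/G$ with $F,G$ coprime and all coefficients in $\mathcal{O}_{\mathbb{L}}$, not all in $m_{\mathbb{L}}$; reducing the coefficients modulo $m_{\mathbb{L}}$ and cancelling common factors gives the reduction $\tilde\phi$, a rational map over $\tilde{\mathbb{L}}$. $\phi$ has good reduction if $\deg\tilde\phi=\deg\phi$. A critical point of $\tilde\phi$ is a point of $\mathbb{P}^1(\tilde{\mathbb{L}})$ at which $\tilde\phi$ has multiplicity (local degree) at least $2$. The action of $\phi$ on $\mathbb{P}^1(\mathbb{L})$ extends uniquely and continuously to the Berkovich projective line $\mathbb{P}^1_{an}$ (with its weak/Berkovich topology), and connectedness is with respect to this topology. *)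

theory Defs
  imports "HOL-Analysis.Analysis" "HOL-Computational_Algebra.Polynomial"
begin

definition nonarch_abs :: "('a::field \<Rightarrow> real) \<Rightarrow> bool" where
  "nonarch_abs absv \<longleftrightarrow>
     (\<forall>x. 0 \<le> absv x) \<and> (\<forall>x. absv x = 0 \<longleftrightarrow> x = 0) \<and>
     (\<forall>x y. absv (x * y) = absv x * absv y) \<and>
     (\<forall>x y. absv (x + y) \<le> max (absv x) (absv y)) \<and>
     (\<exists>x. absv x \<noteq> 0 \<and> absv x \<noteq> 1)"

definition complete_abs :: "('a::field \<Rightarrow> real) \<Rightarrow> bool" where
  "complete_abs absv \<longleftrightarrow>
     (\<forall>X::nat \<Rightarrow> 'a. (\<forall>e>0. \<exists>N. \<forall>m\<ge>N. \<forall>n\<ge>N. absv (X m - X n) < e) \<longrightarrow>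
        (\<exists>l. \<forall>e>0. \<exists>N. \<forall>n\<ge>N. absv (X n - l) < e))"

definition alg_closed_field :: "'a::field itself \<Rightarrow> bool" where
  "alg_closed_field _ \<longleftrightarrow> (\<forall>p::'a poly. 0 < degree p \<longrightarrow> (\<exists>x. poly p x = 0))"

text \<open>A rational map is \<open>\<phi> = f/g\<close> with \<open>f, g\<close> coprime; as a map of \<open>\<P>\<^sup>1\<close> it is
  \<open>[X:Y] \<mapsto> [F(X,Y) : G(X,Y)]\<close> where \<open>F = Y\<^sup>d f(X/Y)\<close>, \<open>G = Y\<^sup>d g(X/Y)\<close>.
  In general a polynomial \<open>p\<close> with \<open>degree p \<le> n\<close> represents the binary form
  \<open>\<Sum> coeff p i X\<^sup>i Y\<^sup>n\<^sup>-\<^sup>i\<close> of degree \<open>n\<close>; products of forms correspond to products of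
  polynomials.\<close>
definition rat_deg :: "'a::field poly \<Rightarrow> 'a poly \<Rightarrow> nat" where
  "rat_deg f g = max (degree f) (degree g)"

definition integral_poly :: "('a::field \<Rightarrow> real) \<Rightarrow> 'a poly \<Rightarrow> bool" where
  "integral_poly absv p \<longleftrightarrow> (\<forall>i. absv (coeff p i) \<le> 1)"

definition nonzero_red :: "('a::field \<Rightarrow> real) \<Rightarrow> 'a poly \<Rightarrow> bool" where
  "nonzero_red absv p \<longleftrightarrow> (\<exists>i. absv (coeff p i) = 1)"

definition cong_m :: "('a::field \<Rightarrow> real) \<Rightarrow> 'a poly \<Rightarrow> 'a poly \<Rightarrow> bool" where
  "cong_m absv p q \<longleftrightarrow> (\<forall>i. absv (coeff p i - coeff q i) < 1)"

definition normalized :: "('a::field \<Rightarrow> real) \<Rightarrow> 'a poly \<Rightarrow> 'a poly \<Rightarrow> bool" where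
  "normalized absv f g \<longleftrightarrow> integral_poly absv f \<and> integral_poly absv g \<and>
     (nonzero_red absv f \<or> nonzero_red absv g)"

text \<open>Over the residue field: the reduction of the form \<open>h\<close> (of degree \<open>k\<close>) divides the
  reduction of the form \<open>p\<close> (of degree \<open>n\<close>).\<close>
definition red_form_dvd ::
  "('a::field \<Rightarrow> real) \<Rightarrow> nat \<Rightarrow> 'a poly \<Rightarrow> nat \<Rightarrow> 'a poly \<Rightarrow> bool" where
  "red_form_dvd absv k h n p \<longleftrightarrow>
     k \<le> n \<and> (\<exists>q. integral_poly absv q \<and> degree q \<le> n - k \<and> cong_m absv p (h * q))"

text \<open>Degree of the common factor of \<open>F~, G~\<close> (degree of their gcd over the residue field).\<close>
definition red_common_deg :: "('a::field \<Rightarrow> real) \<Rightarrow> 'a poly \<Rightarrow> 'a poly \<Rightarrow> nat" where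
  "red_common_deg absv f g = (GREATEST k. k \<le> rat_deg f g \<and>
     (\<exists>h. integral_poly absv h \<and> nonzero_red absv h \<and> degree h \<le> k \<and>
          red_form_dvd absv k h (rat_deg f g) f \<and> red_form_dvd absv k h (rat_deg f g) g))"

text \<open>Degree of the reduction \<open>\<phi>~\<close> (after cancelling common factors); \<open>f,g\<close> normalized.\<close>
definition red_deg :: "('a::field \<Rightarrow> real) \<Rightarrow> 'a poly \<Rightarrow> 'a poly \<Rightarrow> nat" where
  "red_deg absv f g = rat_deg f g - red_common_deg absv f g"

definition good_reduction :: "('a::field \<Rightarrow> real) \<Rightarrow> 'a poly \<Rightarrow> 'a poly \<Rightarrow> bool" where
  "good_reduction absv f g \<longleftrightarrow> red_deg absv f g = rat_deg f g"

definition hom_eval :: "nat \<Rightarrow> 'a::field poly \<Rightarrow> 'a \<Rightarrow> 'a \<Rightarrow> 'a" where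
  "hom_eval n p a b = (\<Sum>i\<le>n. coeff p i * a ^ i * b ^ (n - i))"

text \<open>A point \<open>[a:b]\<close> of \<open>\<P>\<^sup>1(L~)\<close> is represented by \<open>a, b \<in> O\<close> not both in \<open>m\<close>.
  For the reduced map \<open>[F':G']\<close> of degree \<open>n\<close> (forms \<open>f', g'\<close>), the point \<open>P = [a:b]\<close>
  is fixed iff \<open>[F'(P):G'(P)] = [a:b]\<close>, and critical iff the multiplicity of \<open>\<phi>~\<close> at \<open>P\<close>,
  i.e. the order of vanishing at \<open>P\<close> of \<open>e F' - c G'\<close> where \<open>(c,e) = (F'(P),G'(P))\<close>,
  i.e. the multiplicity of the linear factor \<open>bX - aY\<close>, is at least 2.\<close>
definition red_fixed_critical ::
  "('a::field \<Rightarrow> real) \<Rightarrow> nat \<Rightarrow> 'a poly \<Rightarrow> 'a poly \<Rightarrow> 'a \<Rightarrow> 'a \<Rightarrow> bool" where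
  "red_fixed_critical absv n f' g' a b \<longleftrightarrow>
     (let c = hom_eval n f' a b; e = hom_eval n g' a b in
        \<not> (absv c < 1 \<and> absv e < 1) \<and>
        absv (b * c - a * e) < 1 \<and>
        2 \<le> n \<and>
        red_form_dvd absv 2 ([:- a, b:] ^ 2) n (smult e f' - smult c g'))"

text \<open>The reduction \<open>\<phi>~ = F'/G'\<close> (obtained from \<open>F~ = H F'\<close>, \<open>G~ = H G'\<close> with \<open>H\<close> the
  common factor) has a fixed critical point in \<open>\<P>\<^sup>1(L~)\<close>.\<close>
definition red_has_fixed_crit :: "('a::field \<Rightarrow> real) \<Rightarrow> 'a poly \<Rightarrow> 'a poly \<Rightarrow> bool" where
  "red_has_fixed_crit absv f g \<longleftrightarrow>
     (let d = rat_deg f g; r = red_deg absv f g in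
      \<exists>h f' g'. integral_poly absv h \<and> nonzero_red absv h \<and> degree h \<le> d - r \<and>
        integral_poly absv f' \<and> integral_poly absv g' \<and> degree f' \<le> r \<and> degree g' \<le> r \<and>
        cong_m absv f (h * f') \<and> cong_m absv g (h * g') \<and>
        (\<exists>a b. absv a \<le> 1 \<and> absv b \<le> 1 \<and> max (absv a) (absv b) = 1 \<and>
               red_fixed_critical absv r f' g' a b))"

definition berk_A1 :: "('a::field \<Rightarrow> real) \<Rightarrow> ('a poly \<Rightarrow> real) set" where
  "berk_A1 absv = {\<zeta>. (\<forall>p. 0 \<le> \<zeta> p) \<and> (\<forall>p q. \<zeta> (p * q) = \<zeta> p * \<zeta> q) \<and>
      (\<forall>p q. \<zeta> (p + q) \<le> \<zeta> p + \<zeta> q) \<and> (\<forall>c. \<zeta> [:c:] = absv c)}"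

definition berk_A1_top :: "('a::field \<Rightarrow> real) \<Rightarrow> ('a poly \<Rightarrow> real) topology" where
  "berk_A1_top absv = subtopology
     (topology_generated_by {{\<zeta> \<in> berk_A1 absv. \<zeta> p \<in> U} | p U. open U}) (berk_A1 absv)"

text \<open>\<open>P\<^sup>1_an = A\<^sup>1_an \<union> {\<infinity>}\<close> (\<open>None\<close> is \<open>\<infinity>\<close>), the one-point compactification.\<close>
definition berk_P1 :: "('a::field \<Rightarrow> real) \<Rightarrow> ('a poly \<Rightarrow> real) option set" where
  "berk_P1 absv = insert None (Some ` berk_A1 absv)"

definition berk_P1_top :: "('a::field \<Rightarrow> real) \<Rightarrow> ('a poly \<Rightarrow> real) option topology" where
  "berk_P1_top absv = subtopology
     (topology_generated_by
        ({Some ` V | V. openin (berk_A1_top absv) V} \<union>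
         {insert None (Some ` (berk_A1 absv - K)) | K. compactin (berk_A1_top absv) K}))
     (berk_P1 absv)"

text \<open>Homogenised composition: \<open>p(f/g) = hom_comp p f g / g^(degree p)\<close>.\<close>
definition hom_comp :: "'a::field poly \<Rightarrow> 'a poly \<Rightarrow> 'a poly \<Rightarrow> 'a poly" where
  "hom_comp p f g = (\<Sum>i\<le>degree p. smult (coeff p i) (f ^ i * g ^ (degree p - i)))"

definition type1 :: "('a::field \<Rightarrow> real) \<Rightarrow> 'a \<Rightarrow> ('a poly \<Rightarrow> real)" where
  "type1 absv c = (\<lambda>p. absv (poly p c))"

text \<open>The (unique continuous) extension of \<open>\<phi> = f/g\<close> to \<open>P\<^sup>1_an\<close>:
  \<open>[p]_{\<phi>(\<zeta>)} = [p \<circ> \<phi>]_\<zeta>\<close>.\<close>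
definition berk_map ::
  "('a::field \<Rightarrow> real) \<Rightarrow> 'a poly \<Rightarrow> 'a poly \<Rightarrow> ('a poly \<Rightarrow> real) option \<Rightarrow> ('a poly \<Rightarrow> real) option" where
  "berk_map absv f g z = (case z of
      None \<Rightarrow> (if degree g < degree f then None
               else Some (type1 absv (coeff f (degree g) / lead_coeff g)))
    | Some \<zeta> \<Rightarrow> (if \<zeta> g = 0 then None
               else Some (\<lambda>p. \<zeta> (hom_comp p f g) / \<zeta> g ^ degree p)))"

definition berk_fixed_locus ::
  "('a::field \<Rightarrow> real) \<Rightarrow> 'a poly \<Rightarrow> 'a poly \<Rightarrow> ('a poly \<Rightarrow> real) option set" where
  "berk_fixed_locus absv f g = {z \<in> berk_P1 absv. berk_map absv f g z = z}"

end

theory Submission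
  imports Defs
begin

text \<open>A point \<open>z\<close> of \<open>\<P>\<^sup>1_an\<close> is described by its values on binary forms, scaled so that
  \<open>max |X|\<^sub>z |Y|\<^sub>z = 1\<close>; over an algebraically closed field the values on linear forms suffice.
  With \<open>\<parallel>l\<parallel>\<close> the Gauss norm, good reduction of \<open>\<Phi> = (F, G)\<close> gives
  \<open>max |F|\<^sub>z |G|\<^sub>z = 1\<close>, so \<open>z\<close> is fixed iff \<open>|l \<circ> \<Phi>|\<^sub>z = |l|\<^sub>z\<close> for all linear forms \<open>l\<close>.

  Every \<open>z\<close> is joined to the Gauss point by the path \<open>z\<^sub>t\<close> with
  \<open>|l|\<close> at \<open>z\<^sub>t\<close> equal to \<open>max |l|\<^sub>z (t \<parallel>l\<parallel>)\<close>. If \<open>z\<close> is fixed, \<open>\<parallel>l\<parallel> = 1\<close> and \<open>|l|\<^sub>z < 1\<close>, then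
  \<open>l \<circ> \<Phi>\<close> vanishes at the residue class of the root of \<open>l\<close>, which is a fixed point of the
  reduction. If it is not critical, exactly one normalized linear factor \<open>m\<close> of \<open>l \<circ> \<Phi>\<close> vanishes
  there, hence \<open>|l \<circ> \<Phi>| = |m|\<close> along the whole path and all \<open>z\<^sub>t\<close> are fixed.

  Conversely, if the root of \<open>l\<close> is a fixed critical point of the reduction, then
  \<open>l \<circ> \<Phi> = l\<^sup>2 Q + E\<close> with \<open>\<parallel>E\<parallel> = \<rho> < 1\<close>, so a fixed \<open>z\<close> with \<open>|l|\<^sub>z < 1\<close> has \<open>|l|\<^sub>z \<le> \<rho>\<close>. Thus
  \<open>|l|\<^sub>z < 1\<close> cuts out a clopen part of the fixed locus. It contains a zero of \<open>Y F - X G\<close> but not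
  the Gauss point.\<close>

section \<open>Gauss norms\<close>

locale nonarch_field =
  fixes absv :: "'a::field \<Rightarrow> real"
  assumes nonarch: "nonarch_abs absv"
begin

section \<open>Elementary properties of a non-Archimedean absolute value\<close>

lemma absv_nonneg [simp]: "0 \<le> absv x"
  and absv_eq_0_iff [simp]: "absv x = 0 \<longleftrightarrow> x = 0"
  and absv_mult: "absv (x * y) = absv x * absv y"
  and absv_add_le: "absv (x + y) \<le> max (absv x) (absv y)"
  using nonarch by (auto simp: nonarch_abs_def)

lemma absv_0 [simp]: "absv 0 = 0"
  by simp

lemma absv_1 [simp]: "absv 1 = 1"
  using absv_mult[of 1 1] absv_eq_0_iff[of 1] by (simp del: absv_eq_0_iff)

lemma absv_pos_iff [simp]: "0 < absv x \<longleftrightarrow> x \<noteq> 0"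
  using absv_nonneg[of x] absv_eq_0_iff[of x] by linarith

lemma absv_minus [simp]: "absv (- x) = absv x"
proof -
  have "absv (-1) ^ 2 = 1"
    by (simp add: power2_eq_square flip: absv_mult)
  then have "absv (-1) = 1"
    by (metis absv_nonneg abs_of_nonneg power2_eq_1_iff abs_1 abs_minus_cancel)
  then show ?thesis
    using absv_mult[of "-1" x] by simp
qed

lemma absv_diff_commute: "absv (x - y) = absv (y - x)"
  using absv_minus[of "x - y"] by simp

lemma absv_power: "absv (x ^ n) = absv x ^ n"
  by (induction n) (auto simp: absv_mult)

lemma absv_divide: "absv (x / y) = absv x / absv y"
proof (cases "y = 0")
  case False
  then show ?thesis
    using absv_mult[of "x / y" y] by (simp add: field_simps)
qed simp

lemma absv_diff_le: "absv (x - y) \<le> max (absv x) (absv y)"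
  using absv_add_le[of x "- y"] by simp

lemma absv_add_eq: "absv y < absv x \<Longrightarrow> absv (x + y) = absv x"
  using absv_add_le[of x y] absv_diff_le[of "x + y" y] by (auto simp: max_def split: if_splits)

lemma absv_sum_le:
  assumes "\<And>i. i \<in> A \<Longrightarrow> absv (F i) \<le> B" "0 \<le> B"
  shows "absv (sum F A) \<le> B"
  using assms
proof (induction A rule: infinite_finite_induct)
  case (insert x A)
  then have "absv (sum F A) \<le> B" "absv (F x) \<le> B"
    by auto
  then show ?case
    using absv_add_le[of "F x" "sum F A"] insert.hyps by simp
qed auto

lemma absv_sum_less:
  assumes "\<And>i. i \<in> A \<Longrightarrow> absv (F i) < B" "0 < B"
  shows "absv (sum F A) < B"
  using assms
proof (induction A rule: infinite_finite_induct)
  case (insert x A)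
  then have "absv (sum F A) < B" "absv (F x) < B"
    by auto
  then show ?case
    using absv_add_le[of "F x" "sum F A"] insert.hyps by simp
qed auto

text \<open>This is what makes binomial coefficients harmless in
  \<open>berk_A1_ultrametric\<close>.\<close>

lemma absv_of_nat_le_1: "absv (of_nat n) \<le> 1"
proof (induction n)
  case (Suc n)
  then show ?case
    using absv_add_le[of 1 "of_nat n"] by simp
qed simp

text \<open>The Gauss norm of radius \<open>r\<close>, geometrically the closed disc of radius
  \<open>r\<close> about 0. The index set is nonempty even for \<open>p = 0\<close>, so
  \<open>Max\<close> is well defined.\<close>

definition gauss_norm :: "real \<Rightarrow> 'a poly \<Rightarrow> real" where
  "gauss_norm r p = Max ((\<lambda>i. absv (coeff p i) * r ^ i) ` {..degree p})"

lemma gauss_norm_attained: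
  obtains i where "i \<le> degree p" "gauss_norm r p = absv (coeff p i) * r ^ i"
proof -
  have "gauss_norm r p \<in> (\<lambda>i. absv (coeff p i) * r ^ i) ` {..degree p}"
    unfolding gauss_norm_def by (rule Max_in) auto
  then show thesis
    using that by auto
qed

lemma gauss_norm_nonneg [simp]: "0 \<le> r \<Longrightarrow> 0 \<le> gauss_norm r p"
  by (metis gauss_norm_attained absv_nonneg mult_nonneg_nonneg zero_le_power)

lemma coeff_le_gauss_norm: "0 \<le> r \<Longrightarrow> absv (coeff p i) * r ^ i \<le> gauss_norm r p"
proof (cases "i \<le> degree p")
  case True
  then show ?thesis
    by (auto simp: gauss_norm_def)
qed (simp add: coeff_eq_0)

lemma gauss_norm_le_iff:
  "0 \<le> r \<Longrightarrow> gauss_norm r p \<le> B \<longleftrightarrow> (\<forall>i. absv (coeff p i) * r ^ i \<le> B)"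
  by (metis coeff_le_gauss_norm gauss_norm_attained order_trans)

lemma gauss_norm_less_iff:
  "0 \<le> r \<Longrightarrow> gauss_norm r p < B \<longleftrightarrow> (\<forall>i. absv (coeff p i) * r ^ i < B)"
  by (metis coeff_le_gauss_norm gauss_norm_attained order_le_less_trans)

lemma gauss_norm_add_le: "0 \<le> r \<Longrightarrow> gauss_norm r (p + q) \<le> max (gauss_norm r p) (gauss_norm r q)"
proof (subst gauss_norm_le_iff, assumption, intro allI)
  fix i assume r: "0 \<le> r"
  have "absv (coeff (p + q) i) * r ^ i \<le> max (absv (coeff p i)) (absv (coeff q i)) * r ^ i"
    using r by (intro mult_right_mono) (auto simp: absv_add_le)
  also have "\<dots> = max (absv (coeff p i) * r ^ i) (absv (coeff q i) * r ^ i)"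
    using r by (simp add: max_mult_distrib_right)
  also have "\<dots> \<le> max (gauss_norm r p) (gauss_norm r q)"
    using r by (meson coeff_le_gauss_norm max.mono)
  finally show "absv (coeff (p + q) i) * r ^ i \<le> max (gauss_norm r p) (gauss_norm r q)" .
qed

lemma gauss_norm_const [simp]: "gauss_norm r [:c:] = absv c"
  by (simp add: gauss_norm_def)

lemma gauss_norm_eq_0_iff [simp]: "0 < r \<Longrightarrow> gauss_norm r p = 0 \<longleftrightarrow> p = 0"
proof
  assume "0 < r" "gauss_norm r p = 0"
  then have "coeff p i = 0" for i
    using coeff_le_gauss_norm[of r p i] zero_less_power[of r i] absv_nonneg[of "coeff p i"]
    by (auto simp: mult_le_0_iff not_le[symmetric] simp del: absv_nonneg zero_less_power)
  then show "p = 0"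
    by (simp add: poly_eqI)
qed (simp add: gauss_norm_def)

lemma gauss_norm_linear: "0 \<le> r \<Longrightarrow> gauss_norm r [:a, b:] = max (absv a) (absv b * r)"
  by (cases "b = 0") (auto simp: gauss_norm_def atMost_Suc max.commute)

text \<open>Gauss's lemma. If \<open>i\<close> and \<open>j\<close> are the least indices attaining
  the two maxima, the coefficient of index \<open>i + j\<close> in the product has exactly one
  dominant term, so no cancellation can lower its size.\<close>

lemma gauss_norm_mult:
  assumes r: "0 < r"
  shows "gauss_norm r (p * q) = gauss_norm r p * gauss_norm r q"
proof (cases "p = 0 \<or> q = 0")
  case True
  then show ?thesis
    using r by (metis gauss_norm_eq_0_iff mult_eq_0_iff)
next
  case False
  define P where "P = (\<lambda>i. absv (coeff p i) * r ^ i)"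
  define Q where "Q = (\<lambda>i. absv (coeff q i) * r ^ i)"
  define i where "i = (LEAST i. P i = gauss_norm r p)"
  define j where "j = (LEAST i. Q i = gauss_norm r q)"
  have nn: "0 \<le> P k" "0 \<le> Q k" for k
    using r by (auto simp: P_def Q_def)
  have pos: "0 < gauss_norm r p" "0 < gauss_norm r q"
    using False r gauss_norm_nonneg[of r p] gauss_norm_nonneg[of r q] gauss_norm_eq_0_iff[OF r]
    by (metis less_eq_real_def)+
  have le: "P k \<le> gauss_norm r p" "Q k \<le> gauss_norm r q" for k
    using r coeff_le_gauss_norm[of r] by (auto simp: P_def Q_def)
  have ij: "P i = gauss_norm r p" "Q j = gauss_norm r q"
    unfolding i_def j_def
    by (rule LeastI_ex, metis P_def Q_def gauss_norm_attained)+
  have less: "k < i \<Longrightarrow> P k < gauss_norm r p" "k < j \<Longrightarrow> Q k < gauss_norm r q" for k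
    using le[of k] not_less_Least[of k] unfolding i_def j_def by (metis less_eq_real_def)+
  have term_eq: "absv (coeff p k * coeff q (n - k)) * r ^ n = P k * Q (n - k)" if "k \<le> n" for k n
  proof -
    have "r ^ n = r ^ k * r ^ (n - k)"
      using that by (simp flip: power_add)
    then show ?thesis
      by (simp add: P_def Q_def absv_mult)
  qed
  have upper: "absv (coeff (p * q) n) * r ^ n \<le> gauss_norm r p * gauss_norm r q" for n
  proof -
    have "absv (coeff (p * q) n) \<le> gauss_norm r p * gauss_norm r q / r ^ n"
      unfolding coeff_mult
    proof (rule absv_sum_le)
      fix k assume "k \<in> {..n}"
      then show "absv (coeff p k * coeff q (n - k)) \<le> gauss_norm r p * gauss_norm r q / r ^ n"
        using term_eq[of k n] r pos nn le by (simp add: pos_le_divide_eq mult_mono)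
    qed (use r pos in auto)
    then show ?thesis
      using r by (simp add: pos_le_divide_eq)
  qed
  have lower: "absv (coeff (p * q) (i + j)) * r ^ (i + j) = gauss_norm r p * gauss_norm r q"
  proof -
    let ?t = "\<lambda>k. coeff p k * coeff q (i + j - k)"
    have main: "absv (?t i) = gauss_norm r p * gauss_norm r q / r ^ (i + j)"
      using term_eq[of i "i + j"] r ij by (simp add: eq_divide_eq)
    \<comment> \<open>For \<open>k \<noteq> i\<close> either \<open>k < i\<close> or
      \<open>i + j - k < j\<close>, and minimality of \<open>i\<close> and \<open>j\<close> makes
      that factor strictly smaller.\<close>
    have "absv (sum ?t ({..i + j} - {i})) < absv (?t i)"
      unfolding main
    proof (rule absv_sum_less)
      fix k assume k: "k \<in> {..i + j} - {i}"
      have "P k * Q (i + j - k) < gauss_norm r p * gauss_norm r q"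
      proof (cases "k < i")
        case True
        then have "P k * Q (i + j - k) \<le> P k * gauss_norm r q"
          using nn le by (intro mult_left_mono) auto
        also have "\<dots> < gauss_norm r p * gauss_norm r q"
          using less(1)[OF True] pos by simp
        finally show ?thesis .
      next
        case False
        then have "i + j - k < j"
          using k by auto
        then have "P k * Q (i + j - k) < gauss_norm r p * gauss_norm r q"
          using less(2) nn le pos by (meson mult_le_less_imp_less mult_right_mono le_less_trans mult_strict_left_mono)
        then show ?thesis .
      qed
      then show "absv (?t k) < gauss_norm r p * gauss_norm r q / r ^ (i + j)"
        using term_eq[of k "i + j"] k r by (simp add: pos_less_divide_eq)
    qed (use r pos in auto)
    then have "absv (coeff (p * q) (i + j)) = absv (?t i)"
      unfolding coeff_mult by (subst sum.remove[of _ i]) (auto simp: absv_add_eq)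
    then show ?thesis
      using main r by simp
  qed
  show ?thesis
  proof (rule antisym)
    show "gauss_norm r (p * q) \<le> gauss_norm r p * gauss_norm r q"
      using r upper by (subst gauss_norm_le_iff) auto
    show "gauss_norm r p * gauss_norm r q \<le> gauss_norm r (p * q)"
      using r lower coeff_le_gauss_norm[of r "p * q" "i + j"] by simp
  qed
qed

section \<open>Radius one and reduction modulo the maximal ideal\<close>

abbreviation gauss :: "'a poly \<Rightarrow> real" where
  "gauss \<equiv> gauss_norm 1"

lemma gauss_0 [simp]: "gauss 0 = 0"
  by simp

lemma gauss_smult: "gauss (smult c p) = absv c * gauss p"
  using gauss_norm_mult[of 1 "[:c:]" p] by simp

lemma gauss_minus [simp]: "gauss (- p) = gauss p"
  using gauss_smult[of "-1" p] by simp

lemma gauss_diff_le: "gauss (p - q) \<le> max (gauss p) (gauss q)"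
  using gauss_norm_add_le[of 1 p "- q"] by simp

lemma coeff_le_gauss: "absv (coeff p i) \<le> gauss p"
  using coeff_le_gauss_norm[of 1 p i] by simp

lemma gauss_add_less: "gauss p < 1 \<Longrightarrow> gauss q < 1 \<Longrightarrow> gauss (p + q) < 1"
  using gauss_norm_add_le[of 1 p q] by simp

lemma gauss_diff_less: "gauss p < 1 \<Longrightarrow> gauss q < 1 \<Longrightarrow> gauss (p - q) < 1"
  using gauss_diff_le[of p q] by simp

lemma gauss_mult_less: "gauss p < 1 \<Longrightarrow> gauss q \<le> 1 \<Longrightarrow> gauss (p * q) < 1"
  using mult_left_le[of "gauss q" "gauss p"] by (simp add: gauss_norm_mult)

lemma gauss_smult_less: "absv c < 1 \<Longrightarrow> gauss p \<le> 1 \<Longrightarrow> gauss (smult c p) < 1"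
  using gauss_mult_less[of "[:c:]" p] by simp

lemma gauss_smult_le_less: "absv c \<le> 1 \<Longrightarrow> gauss p < 1 \<Longrightarrow> gauss (smult c p) < 1"
  using gauss_mult_less[of p "[:c:]"] by (simp add: mult.commute[of p])

lemma gauss_monom [simp]: "gauss (monom c n) = absv c"
proof (rule antisym)
  show "gauss (monom c n) \<le> absv c"
    by (simp add: gauss_norm_le_iff)
  show "absv c \<le> gauss (monom c n)"
    using coeff_le_gauss[of "monom c n" n] by simp
qed

lemma integral_poly_iff: "integral_poly absv p \<longleftrightarrow> gauss p \<le> 1"
  by (simp add: integral_poly_def gauss_norm_le_iff)

lemma cong_m_iff: "cong_m absv p q \<longleftrightarrow> gauss (p - q) < 1"
  by (simp add: cong_m_def gauss_norm_less_iff)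

lemma integral_nonzero_red_iff:
  "integral_poly absv p \<Longrightarrow> nonzero_red absv p \<longleftrightarrow> gauss p = 1"
  unfolding integral_poly_iff nonzero_red_def
  by (metis antisym coeff_le_gauss gauss_norm_attained mult_1_right power_one)

text \<open>The point of the closed disc of radius \<open>r\<close> about \<open>c\<close>:
  substituting \<open>c + X\<close> moves the centre to 0. These supply the new points on the
  paths.\<close>

definition disc :: "'a \<Rightarrow> real \<Rightarrow> 'a poly \<Rightarrow> real" where
  "disc c r p = gauss_norm r (pcompose p [:c, 1:])"

lemma disc_in_berk_A1:
  assumes "0 < r"
  shows "disc c r \<in> berk_A1 absv"
proof -
  have "disc c r (p + q) \<le> disc c r p + disc c r q" for p q
    using assms gauss_norm_add_le[of r "pcompose p [:c, 1:]" "pcompose q [:c, 1:]"]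
      gauss_norm_nonneg[of r "pcompose p [:c, 1:]"] gauss_norm_nonneg[of r "pcompose q [:c, 1:]"]
    by (simp add: disc_def pcompose_add le_max_iff_disj del: gauss_norm_nonneg, linarith)
  then show ?thesis
    using assms by (simp add: berk_A1_def pcompose_mult pcompose_const gauss_norm_mult disc_def)
qed

lemma disc_linear: "0 < r \<Longrightarrow> disc c r [:-b, 1:] = max (absv (c - b)) r"
  by (simp add: disc_def pcompose_pCons gauss_norm_linear)

end

section \<open>Norms of binary forms at points of the Berkovich line\<close>

lemma mult_eq_1_le_1D:
  fixes x y :: real
  assumes "x * y = 1" "0 \<le> x" "x \<le> 1" "0 \<le> y" "y \<le> 1"
  shows "x = 1 \<and> y = 1"
  using assms mult_left_le[of x y] mult_left_le[of y x] by (simp add: mult.commute)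

lemma coeff_mult_top:
  assumes "degree p \<le> m" "degree q \<le> n"
  shows "coeff (p * q) (m + n) = coeff p m * coeff q n"
proof -
  have "coeff p i * coeff q (m + n - i) = (if i = m then coeff p m * coeff q n else 0)" for i
    using assms by (cases i m rule: linorder_cases) (auto simp: coeff_eq_0)
  then show ?thesis
    by (simp add: coeff_mult)
qed

text \<open>The linear form \<open>b X - a Y\<close> with zero \<open>[a:b]\<close>.\<close>
abbreviation lin :: "'a::field \<Rightarrow> 'a \<Rightarrow> 'a poly" where
  "lin a b \<equiv> [:- a, b:]"

lemma degree_lin: "degree (lin a b) \<le> 1"
  by simp

lemma hom_eval_eq_poly:
  assumes "degree p \<le> n" "b \<noteq> 0"
  shows "hom_eval n p a b = b ^ n * poly p (a / b)"
proof -
  have "poly p (a / b) = (\<Sum>i\<le>n. coeff p i * (a / b) ^ i)"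
    unfolding poly_altdef using assms(1)
    by (intro sum.mono_neutral_left) (auto simp: coeff_eq_0)
  then show ?thesis
    using assms(2)
    by (auto intro!: sum.cong simp: hom_eval_def sum_distrib_left power_divide power_diff mult_ac)
qed

lemma hom_eval_at_infinity: "hom_eval n p a 0 = coeff p n * a ^ n"
proof -
  have "hom_eval n p a 0 = (\<Sum>i\<le>n. if i = n then coeff p n * a ^ n else 0)"
    unfolding hom_eval_def by (rule sum.cong) auto
  then show ?thesis
    by simp
qed

lemma hom_eval_mult:
  assumes "degree p \<le> m" "degree q \<le> n"
  shows "hom_eval (m + n) (p * q) a b = hom_eval m p a b * hom_eval n q a b"
proof (cases "b = 0")
  case True
  then show ?thesis
    using assms by (simp add: hom_eval_at_infinity coeff_mult_top power_add)
next
  case False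
  moreover have "degree (p * q) \<le> m + n"
    using assms degree_mult_le[of p q] by linarith
  ultimately show ?thesis
    using assms by (simp add: hom_eval_eq_poly power_add)
qed

lemma hom_eval_add: "hom_eval n (p + q) a b = hom_eval n p a b + hom_eval n q a b"
  and hom_eval_diff: "hom_eval n (p - q) a b = hom_eval n p a b - hom_eval n q a b"
  and hom_eval_smult: "hom_eval n (smult c p) a b = c * hom_eval n p a b"
  by (simp_all add: hom_eval_def algebra_simps sum.distrib sum_subtractf sum_distrib_left)

lemma hom_eval_lin: "hom_eval (Suc 0) (lin c e) a b = e * a - c * b"
  by (simp add: hom_eval_def)

lemma hom_eval_const: "hom_eval 0 [:c:] a b = c"
  by (simp add: hom_eval_def)

text \<open>By Bernoulli's inequality, a number above 1 has even powers that grow at least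
  quadratically in the exponent, against a linear bound.\<close>

lemma le_1_if_powers_le_linear:
  fixes x :: real
  assumes "\<And>n. x ^ n \<le> real n + 1"
  shows "x \<le> 1"
proof (rule ccontr)
  assume "\<not> x \<le> 1"
  define e where "e = x - 1"
  have e: "e > 0" "x = 1 + e"
    using \<open>\<not> x \<le> 1\<close> by (auto simp: e_def)
  \<comment> \<open>Large enough that the square of \<open>n * e\<close> exceeds
    \<open>2 * n\<close>, so that the square of Bernoulli's bound beats
    \<open>2 * n + 1\<close>.\<close>
  obtain n :: nat where n: "2 / e ^ 2 < real n"
    using reals_Archimedean2 by blast
  then have n2: "2 < real n * e ^ 2"
    using e by (simp add: field_simps)
  then have "n > 0"
    by (cases n) auto
  have "(1 + real n * e) ^ 2 \<le> (x ^ n) ^ 2"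
    using e Bernoulli_inequality[of e n] by (intro power_mono) (auto simp: mult.commute)
  also have "\<dots> = x ^ (2 * n)"
    by (simp add: power_mult mult.commute flip: power_mult)
  also have "\<dots> \<le> 2 * real n + 1"
    using assms[of "2 * n"] by simp
  finally have "2 * e * real n + real n * (real n * e ^ 2) \<le> real n * 2"
    by (simp add: power2_eq_square algebra_simps)
  moreover have "real n * 2 < real n * (real n * e ^ 2)"
    using n2 \<open>n > 0\<close> by simp
  moreover have "0 \<le> 2 * e * real n"
    using e by simp
  ultimately show False
    by linarith
qed

context nonarch_field
begin

section \<open>Seminorms on the affine line are ultrametric\<close>

lemma berk_A1_nonneg: "\<zeta> \<in> berk_A1 absv \<Longrightarrow> 0 \<le> \<zeta> p"
  and berk_A1_mult: "\<zeta> \<in> berk_A1 absv \<Longrightarrow> \<zeta> (p * q) = \<zeta> p * \<zeta> q"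
  and berk_A1_add: "\<zeta> \<in> berk_A1 absv \<Longrightarrow> \<zeta> (p + q) \<le> \<zeta> p + \<zeta> q"
  and berk_A1_const: "\<zeta> \<in> berk_A1 absv \<Longrightarrow> \<zeta> [:c:] = absv c"
  by (auto simp: berk_A1_def)

lemma berk_A1_smult: "\<zeta> \<in> berk_A1 absv \<Longrightarrow> \<zeta> (smult c p) = absv c * \<zeta> p"
  using berk_A1_mult[of \<zeta> "[:c:]" p] by (simp add: berk_A1_const)

lemma berk_A1_power: "\<zeta> \<in> berk_A1 absv \<Longrightarrow> \<zeta> (p ^ n) = \<zeta> p ^ n"
  using berk_A1_const[of \<zeta> 1] by (induction n) (auto simp: berk_A1_mult one_pCons)

lemma berk_A1_sum: "\<zeta> \<in> berk_A1 absv \<Longrightarrow> \<zeta> (sum F A) \<le> (\<Sum>i\<in>A. \<zeta> (F i))"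
proof (induction A rule: infinite_finite_induct)
  case (insert x A)
  then show ?case
    using berk_A1_add[of \<zeta> "F x" "sum F A"] by simp
qed (use berk_A1_const[of \<zeta> 0] in auto)

text \<open>Membership in \<open>berk_A1\<close> only gives the triangle inequality. Expanding the
  \<open>n\<close>-th power of \<open>p + q\<close>, with binomial coefficients of absolute value at
  most 1, leaves \<open>n + 1\<close> terms of size at most \<open>M ^ n\<close>; a factor linear in
  \<open>n\<close> cannot make up for a value above \<open>M\<close>.\<close>

lemma berk_A1_ultrametric:
  assumes \<zeta>: "\<zeta> \<in> berk_A1 absv"
  shows "\<zeta> (p + q) \<le> max (\<zeta> p) (\<zeta> q)"
proof -
  define M where "M = max (\<zeta> p) (\<zeta> q)"
  have M: "0 \<le> M" "\<zeta> p \<le> M" "\<zeta> q \<le> M"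
    using berk_A1_nonneg[OF \<zeta>, of p] by (auto simp: M_def)
  have pow: "\<zeta> (p + q) ^ n \<le> (real n + 1) * M ^ n" for n
  proof -
    have term_le: "\<zeta> (of_nat (n choose k) * p ^ k * q ^ (n - k)) \<le> M ^ n" if "k \<le> n" for k
    proof -
      have "\<zeta> (of_nat (n choose k) * p ^ k * q ^ (n - k))
          = absv (of_nat (n choose k)) * (\<zeta> p ^ k * \<zeta> q ^ (n - k))"
        using \<zeta> by (simp add: berk_A1_mult berk_A1_power of_nat_poly berk_A1_smult)
      also have "\<dots> \<le> 1 * (M ^ k * M ^ (n - k))"
        using M berk_A1_nonneg[OF \<zeta>] by (intro mult_mono power_mono absv_of_nat_le_1) auto
      also have "\<dots> = M ^ n"
        using that by (simp flip: power_add)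
      finally show ?thesis .
    qed
    have "\<zeta> (p + q) ^ n = \<zeta> (\<Sum>k\<le>n. of_nat (n choose k) * p ^ k * q ^ (n - k))"
      using \<zeta> by (simp add: binomial_ring flip: berk_A1_power)
    also have "\<dots> \<le> (\<Sum>k\<le>n. \<zeta> (of_nat (n choose k) * p ^ k * q ^ (n - k)))"
      using \<zeta> by (rule berk_A1_sum)
    also have "\<dots> \<le> (\<Sum>k\<le>n. M ^ n)"
      by (intro sum_mono term_le) auto
    finally show ?thesis
      by (simp add: algebra_simps)
  qed
  have "\<zeta> (p + q) \<le> M"
  proof (cases "M = 0")
    case True
    then show ?thesis
      using pow[of 1] by simp
  next
    case False
    then have "\<zeta> (p + q) / M \<le> 1"
      using M pow by (intro le_1_if_powers_le_linear) (simp add: power_divide divide_le_eq)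
    then show ?thesis
      using False M by (simp add: divide_le_eq)
  qed
  then show ?thesis
    by (simp add: M_def)
qed

text \<open>The value at \<open>z\<close> of the form of degree \<open>n\<close> represented by \<open>p\<close>, scaled so that
  \<open>max |X|\<^sub>z |Y|\<^sub>z = 1\<close>; meaningful for \<open>degree p \<le> n\<close> only.\<close>
definition form_norm :: "('a poly \<Rightarrow> real) option \<Rightarrow> nat \<Rightarrow> 'a poly \<Rightarrow> real" where
  "form_norm z n p = (case z of None \<Rightarrow> absv (coeff p n)
     | Some \<zeta> \<Rightarrow> \<zeta> p / max 1 (\<zeta> [:0, 1:]) ^ n)"

lemma form_norm_None: "form_norm None n p = absv (coeff p n)"
  and form_norm_Some: "form_norm (Some \<zeta>) n p = \<zeta> p / max 1 (\<zeta> [:0, 1:]) ^ n"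
  by (simp_all add: form_norm_def)

lemma berk_P1_cases [consumes 1, case_names None Some]:
  assumes "z \<in> berk_P1 absv"
  obtains "z = None" | \<zeta> where "z = Some \<zeta>" "\<zeta> \<in> berk_A1 absv"
  using assms by (auto simp: berk_P1_def)

lemma form_norm_nonneg: "z \<in> berk_P1 absv \<Longrightarrow> 0 \<le> form_norm z n p"
  by (cases z rule: berk_P1_cases) (auto simp: form_norm_def berk_A1_nonneg)

lemma form_norm_smult:
  "z \<in> berk_P1 absv \<Longrightarrow> form_norm z n (smult c p) = absv c * form_norm z n p"
  by (cases z rule: berk_P1_cases) (auto simp: form_norm_def berk_A1_smult absv_mult)

lemma form_norm_0: "z \<in> berk_P1 absv \<Longrightarrow> form_norm z n 0 = 0"
  using form_norm_smult[of z n 0 0] by simp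

lemma form_norm_const: "z \<in> berk_P1 absv \<Longrightarrow> form_norm z 0 [:c:] = absv c"
  by (cases z rule: berk_P1_cases) (auto simp: form_norm_def berk_A1_const)

lemma form_norm_mult:
  assumes "z \<in> berk_P1 absv" "degree p \<le> m" "degree q \<le> n"
  shows "form_norm z (m + n) (p * q) = form_norm z m p * form_norm z n q"
  using assms
  by (cases z rule: berk_P1_cases)
    (auto simp: form_norm_def berk_A1_mult coeff_mult_top absv_mult power_add)

lemma form_norm_add_le:
  assumes "z \<in> berk_P1 absv"
  shows "form_norm z n (p + q) \<le> max (form_norm z n p) (form_norm z n q)"
  using assms
proof (cases z rule: berk_P1_cases)
  case (Some \<zeta>)
  then show ?thesis
    using berk_A1_ultrametric[of \<zeta> p q]
    by (auto simp: form_norm_def le_max_iff_disj divide_le_cancel not_less intro: disjI1)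
qed (auto simp: form_norm_def absv_add_le)

lemma form_norm_minus: "z \<in> berk_P1 absv \<Longrightarrow> form_norm z n (- p) = form_norm z n p"
  using form_norm_smult[of z n "-1" p] by simp

lemma form_norm_diff_le:
  "z \<in> berk_P1 absv \<Longrightarrow> form_norm z n (p - q) \<le> max (form_norm z n p) (form_norm z n q)"
  using form_norm_add_le[of z n p "- q"] by (simp add: form_norm_minus)

lemma max_form_norm_coordinates:
  "z \<in> berk_P1 absv \<Longrightarrow> max (form_norm z 1 [:0, 1:]) (form_norm z 1 [:1:]) = 1"
  by (cases z rule: berk_P1_cases) (auto simp: form_norm_def berk_A1_const max_def)

text \<open>Horner's scheme \<open>p = a + X q\<close>: both coordinates have norm at most 1 at
  \<open>z\<close>, so neither the factor \<open>X\<close> nor the powers of \<open>Y\<close> on the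
  constant can increase a value.\<close>

lemma form_norm_le_gauss:
  assumes z: "z \<in> berk_P1 absv"
  shows "degree p \<le> n \<Longrightarrow> form_norm z n p \<le> gauss p"
proof (induction n arbitrary: p)
  case 0
  then show ?case
    by (metis z degree_eq_zeroE form_norm_const gauss_norm_const le_zero_eq order_refl)
next
  case (Suc n)
  obtain a q where p: "p = pCons a q"
    by (cases p)
  have q: "degree q \<le> n"
    using Suc.prems p by (auto split: if_splits)
  have a: "absv a \<le> gauss p"
    using coeff_le_gauss[of p 0] p by simp
  have gq: "gauss q \<le> gauss p"
    using coeff_le_gauss[of p "Suc _"] p by (simp add: gauss_norm_le_iff)
  have coord: "form_norm z 1 [:0, 1:] \<le> 1"
    using max_form_norm_coordinates[OF z] by linarith
  have "form_norm z (1 + n) ([:0, 1:] * q) = form_norm z 1 [:0, 1:] * form_norm z n q"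
    using z q by (intro form_norm_mult) auto
  also have "\<dots> \<le> 1 * gauss q"
    using coord Suc.IH[OF q] form_norm_nonneg[OF z] by (intro mult_mono) auto
  finally have X: "form_norm z (Suc n) ([:0, 1:] * q) \<le> gauss p"
    using gq by simp
  have "form_norm z (Suc n) [:a:] \<le> absv a"
    using z
  proof (cases z rule: berk_P1_cases)
    case (Some \<zeta>)
    have "absv a / max 1 (\<zeta> [:0, 1:]) ^ Suc n \<le> absv a / 1"
      by (intro divide_left_mono) (auto simp del: power_Suc)
    with Some show ?thesis
      by (simp add: form_norm_def berk_A1_const)
  qed (simp add: form_norm_def)
  then have "form_norm z (Suc n) ([:a:] + [:0, 1:] * q) \<le> gauss p"
    using form_norm_add_le[OF z, of "Suc n" "[:a:]" "[:0, 1:] * q"] X a by linarith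
  then show ?case
    by (simp add: p)
qed

lemma gauss_lin: "gauss (lin a b) = max (absv a) (absv b)"
  by (simp add: gauss_norm_linear)

lemma gauss_in_berk_P1: "Some gauss \<in> berk_P1 absv"
  using disc_in_berk_A1[of 1 0] by (simp add: berk_P1_def disc_def[abs_def])

lemma form_norm_gauss: "form_norm (Some gauss) n p = gauss p"
  by (simp add: form_norm_def gauss_norm_linear)

lemma absv_hom_eval_le_gauss:
  assumes "absv a \<le> 1" "absv b \<le> 1"
  shows "absv (hom_eval n p a b) \<le> gauss p"
  unfolding hom_eval_def
proof (rule absv_sum_le)
  fix i
  have "absv a ^ i * absv b ^ (n - i) \<le> 1"
    using assms by (intro mult_le_one power_le_one) auto
  then have "absv (coeff p i) * (absv a ^ i * absv b ^ (n - i)) \<le> gauss p * 1"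
    by (intro mult_mono coeff_le_gauss) auto
  then show "absv (coeff p i * a ^ i * b ^ (n - i)) \<le> gauss p"
    by (simp add: absv_mult absv_power mult.assoc)
qed simp

definition classical_point :: "'a \<Rightarrow> 'a \<Rightarrow> ('a poly \<Rightarrow> real) option" where
  "classical_point a b = (if b = 0 then None else Some (type1 absv (a / b)))"

lemma type1_in_berk_A1: "type1 absv c \<in> berk_A1 absv"
proof -
  have "absv (x + y) \<le> absv x + absv y" for x y
    using absv_add_le[of x y] absv_nonneg[of x] absv_nonneg[of y]
    by (simp add: le_max_iff_disj del: absv_nonneg) linarith
  then show ?thesis
    by (simp add: berk_A1_def type1_def absv_mult)
qed

lemma classical_point_in_berk_P1: "classical_point a b \<in> berk_P1 absv"
  by (simp add: classical_point_def berk_P1_def type1_in_berk_A1)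

text \<open>For normalized coordinates with \<open>b \<noteq> 0\<close> the scaling factor is
  \<open>1 / absv b\<close>, which accounts exactly for the power \<open>b ^ n\<close> in the
  homogeneous evaluation.\<close>

lemma form_norm_classical_point:
  assumes "max (absv a) (absv b) = 1" "degree p \<le> n"
  shows "form_norm (classical_point a b) n p = absv (hom_eval n p a b)"
proof (cases "b = 0")
  case True
  then show ?thesis
    using assms
    by (simp add: classical_point_def form_norm_def hom_eval_at_infinity absv_mult absv_power)
next
  case False
  have "max 1 (absv (a / b)) = 1 / absv b"
    using assms(1) False by (auto simp: absv_divide max_def field_simps split: if_splits)
  then show ?thesis
    using False assms(2)
    by (simp add: classical_point_def form_norm_def type1_def hom_eval_eq_poly absv_mult absv_power
        power_divide)
qed

end

section \<open>Topology of the Berkovich line\<close>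

context nonarch_field
begin

lemma topspace_berk_A1_top: "topspace (berk_A1_top absv) = berk_A1 absv"
proof -
  have "{\<zeta> \<in> berk_A1 absv. \<zeta> 0 \<in> UNIV} \<in> {{\<zeta> \<in> berk_A1 absv. \<zeta> p \<in> U} | p U. open U}"
    by blast
  then show ?thesis
    by (auto simp: berk_A1_top_def)
qed

lemma continuous_map_berk_A1_eval: "continuous_map (berk_A1_top absv) euclideanreal (\<lambda>\<zeta>. \<zeta> p)"
  unfolding continuous_map_def topspace_berk_A1_top
proof (intro conjI allI impI)
  fix U :: "real set" assume "openin euclideanreal U"
  then have "openin (topology_generated_by {{\<zeta> \<in> berk_A1 absv. \<zeta> p \<in> U} | p U. open U})
      {\<zeta> \<in> berk_A1 absv. \<zeta> p \<in> U}"
    by (intro topology_generated_by_Basis) auto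
  then show "openin (berk_A1_top absv) {\<zeta> \<in> berk_A1 absv. \<zeta> p \<in> U}"
    by (auto simp: berk_A1_top_def openin_subtopology)
qed simp

text \<open>Both topologies are the coarsest one making every evaluation continuous. Viewing the
  affine line inside a product of copies of the reals gives access to Tychonoff's theorem and to the
  Hausdorff property.\<close>

lemma berk_A1_top_eq: "berk_A1_top absv = subtopology euclidean (berk_A1 absv)"
proof -
  let ?S = "{{\<zeta> \<in> berk_A1 absv. \<zeta> p \<in> U} | p U. open U}"
  have "continuous_map (berk_A1_top absv) euclidean (\<lambda>\<zeta>. \<zeta>)"
    unfolding euclidean_product_topology[symmetric] continuous_map_componentwise_UNIV
    using continuous_map_berk_A1_eval by blast
  then have 1: "continuous_map (berk_A1_top absv) (subtopology euclidean (berk_A1 absv)) (\<lambda>\<zeta>. \<zeta>)"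
    by (simp add: continuous_map_in_subtopology topspace_berk_A1_top)
  have "continuous_map (subtopology euclidean (berk_A1 absv)) (topology_generated_by ?S) (\<lambda>\<zeta>. \<zeta>)"
  proof (rule continuous_on_generated_topo)
    fix W assume "W \<in> ?S"
    then obtain p U where W: "W = {\<zeta> \<in> berk_A1 absv. \<zeta> p \<in> U}" "open U"
      by blast
    have "open {\<zeta>. \<zeta> p \<in> U}"
      using open_vimage[OF W(2) continuous_on_product_coordinates] by (simp add: vimage_def)
    then have "openin (subtopology euclidean (berk_A1 absv)) (berk_A1 absv \<inter> {\<zeta>. \<zeta> p \<in> U})"
      by (rule openin_open_Int)
    then show "openin (subtopology euclidean (berk_A1 absv))
        ((\<lambda>\<zeta>. \<zeta>) -` W \<inter> topspace (subtopology euclidean (berk_A1 absv)))"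
      by (simp add: W Int_def vimage_def conj_commute conj_left_commute cong: conj_cong)
  next
    have "{\<zeta> \<in> berk_A1 absv. \<zeta> 0 \<in> UNIV} \<in> ?S"
      by blast
    then show "(\<lambda>\<zeta>. \<zeta>) ` topspace (subtopology euclidean (berk_A1 absv)) \<subseteq> \<Union> ?S"
      by auto
  qed
  then have 2: "continuous_map (subtopology euclidean (berk_A1 absv)) (berk_A1_top absv) (\<lambda>\<zeta>. \<zeta>)"
    by (simp add: berk_A1_top_def continuous_map_in_subtopology)
  show ?thesis
    unfolding topology_eq
  proof (intro allI iffI)
    fix S assume S: "openin (berk_A1_top absv) S"
    then have "{x \<in> berk_A1 absv. x \<in> S} = S"
      using openin_subset topspace_berk_A1_top by blast
    then show "openin (subtopology euclidean (berk_A1 absv)) S"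
      using openin_continuous_map_preimage[OF 2 S] by simp
  next
    fix S assume S: "openin (subtopology euclidean (berk_A1 absv)) S"
    then have "{x \<in> berk_A1 absv. x \<in> S} = S"
      using openin_subset by fastforce
    then show "openin (berk_A1_top absv) S"
      using openin_continuous_map_preimage[OF 1 S] by (simp add: topspace_berk_A1_top)
  qed
qed

lemma continuous_map_into_berk_A1_top:
  assumes "h \<in> topspace X \<rightarrow> berk_A1 absv"
    and "\<And>p. continuous_map X euclideanreal (\<lambda>x. h x p)"
  shows "continuous_map X (berk_A1_top absv) h"
  using assms
  by (simp add: berk_A1_top_eq continuous_map_in_subtopology continuous_map_componentwise_UNIV
      flip: euclidean_product_topology)

text \<open>Bounding the coordinate bounds every value, which places a Berkovich disc inside a
  product of compact intervals.\<close>

lemma berk_A1_le_sum: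
  assumes \<zeta>: "\<zeta> \<in> berk_A1 absv" and R: "\<zeta> [:0, 1:] \<le> R"
  shows "\<zeta> p \<le> (\<Sum>i\<le>degree p. absv (coeff p i) * R ^ i)"
proof -
  have "\<zeta> p = \<zeta> (\<Sum>i\<le>degree p. monom (coeff p i) i)"
    by (simp add: poly_as_sum_of_monoms)
  also have "\<dots> \<le> (\<Sum>i\<le>degree p. \<zeta> (monom (coeff p i) i))"
    by (rule berk_A1_sum[OF \<zeta>])
  also have "\<dots> \<le> (\<Sum>i\<le>degree p. absv (coeff p i) * R ^ i)"
    using R berk_A1_nonneg[OF \<zeta>]
    by (intro sum_mono) (auto simp: monom_altdef berk_A1_smult[OF \<zeta>] berk_A1_power[OF \<zeta>]
        intro!: mult_left_mono power_mono)
  finally show ?thesis .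
qed

lemma closed_berk_A1: "closed (berk_A1 absv)"
  unfolding berk_A1_def
  by (intro closed_Collect_conj closed_Collect_all closed_Collect_le closed_Collect_eq
      continuous_intros continuous_on_product_coordinates)

text \<open>By \<open>berk_A1_le_sum\<close> the disc is a closed subset of the box
  \<open>?B\<close>, which is compact by Tychonoff's theorem.\<close>

lemma compactin_berk_disc:
  "compactin (berk_A1_top absv) {\<zeta> \<in> berk_A1 absv. \<zeta> [:0, 1:] \<le> R}"
proof -
  let ?K = "{\<zeta> \<in> berk_A1 absv. \<zeta> [:0, 1:] \<le> R}"
  let ?B = "PiE UNIV (\<lambda>p. {0..\<Sum>i\<le>degree p. absv (coeff p i) * R ^ i})"
  have "compactin (product_topology (\<lambda>_. euclideanreal) UNIV) ?B"
    by (simp add: compactin_PiE)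
  then have "compact ?B"
    by (simp add: euclidean_product_topology)
  moreover have "closed ?K"
    unfolding Collect_conj_eq Collect_mem_eq
    by (intro closed_Int closed_berk_A1 closed_Collect_le continuous_on_const
        continuous_on_product_coordinates)
  ultimately have "compact (?K \<inter> ?B)"
    by (rule closed_Int_compact[rotated])
  moreover have "?K \<inter> ?B = ?K"
    using berk_A1_le_sum by (auto simp: berk_A1_nonneg)
  ultimately show ?thesis
    by (simp add: berk_A1_top_eq compactin_subtopology subset_iff)
qed

lemma Hausdorff_berk_A1_top: "Hausdorff_space (berk_A1_top absv)"
  unfolding berk_A1_top_eq
  by (intro Hausdorff_space_subtopology)
    (simp add: Hausdorff_space_product_topology flip: euclidean_product_topology)

section \<open>Open sets and continuity on the projective line\<close>

lemma openin_berk_P1_top_basis: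
  assumes "openin (berk_A1_top absv) V"
  shows "openin (berk_P1_top absv) (Some ` V)"
proof -
  have "V \<subseteq> berk_A1 absv"
    using assms openin_subset topspace_berk_A1_top by blast
  then have "Some ` V = Some ` V \<inter> berk_P1 absv"
    by (auto simp: berk_P1_def)
  then show ?thesis
    unfolding berk_P1_top_def openin_subtopology using assms
    by (metis (mono_tags, lifting) UnI1 mem_Collect_eq topology_generated_by_Basis)
qed

lemma openin_berk_P1_top_infinity:
  assumes "compactin (berk_A1_top absv) K"
  shows "openin (berk_P1_top absv) (insert None (Some ` (berk_A1 absv - K)))"
proof -
  have "insert None (Some ` (berk_A1 absv - K)) = insert None (Some ` (berk_A1 absv - K)) \<inter> berk_P1 absv"
    by (auto simp: berk_P1_def)
  then show ?thesis
    unfolding berk_P1_top_def openin_subtopology using assms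
    by (metis (mono_tags, lifting) UnI2 mem_Collect_eq topology_generated_by_Basis)
qed

text \<open>Supplies the open sets that disconnect the fixed locus. At finite points this is
  continuity of a quotient of evaluations; near infinity the norm tends to \<open>absv b\<close>,
  because \<open>\<zeta> (lin a b)\<close> differs from \<open>absv b\<close> times the value of
  \<open>X\<close> by at most \<open>absv a\<close>.\<close>

lemma openin_form_norm_lin:
  assumes W: "open W"
  shows "openin (berk_P1_top absv) {z \<in> berk_P1 absv. form_norm z 1 (lin a b) \<in> W}"
    (is "openin _ ?S")
proof -
  define V where "V = {\<zeta> \<in> berk_A1 absv. \<zeta> (lin a b) / max 1 (\<zeta> [:0, 1:]) \<in> W}"
  have "continuous_map (berk_A1_top absv) euclideanreal (\<lambda>\<zeta>. \<zeta> (lin a b) / max 1 (\<zeta> [:0, 1:]))"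
    by (intro continuous_map_real_divide continuous_map_real_max continuous_map_berk_A1_eval) auto
  from openin_continuous_map_preimage[OF this, of W] have V: "openin (berk_A1_top absv) V"
    using W by (simp add: V_def topspace_berk_A1_top)
  have S: "?S = Some ` V \<union> {z. z = None \<and> absv b \<in> W}"
    by (auto simp: V_def berk_P1_def form_norm_def)
  show ?thesis
  proof (cases "absv b \<in> W")
    case False
    then show ?thesis
      unfolding S using openin_berk_P1_top_basis[OF V] by simp
  next
    case True
    then obtain e where e: "e > 0" "\<And>x. \<bar>x - absv b\<bar> < e \<Longrightarrow> x \<in> W"
      using W by (metis open_dist dist_real_def)
    \<comment> \<open>Beyond \<open>R\<close> the coordinate exceeds 1, so it is the scaling factor,
      and \<open>absv a\<close> divided by it is below \<open>e\<close>.\<close>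
    define R where "R = max 1 (absv a / e)"
    define K where "K = {\<zeta> \<in> berk_A1 absv. \<zeta> [:0, 1:] \<le> R}"
    have "\<zeta> \<in> V" if \<zeta>: "\<zeta> \<in> berk_A1 absv" "\<zeta> \<notin> K" for \<zeta>
    proof -
      define t where "t = \<zeta> [:0, 1:]"
      have t: "t > 1" "absv a / e < t"
        using \<zeta> by (auto simp: K_def R_def t_def)
      have bX: "\<zeta> [:0, b:] = absv b * t"
        using berk_A1_smult[OF \<zeta>(1), of b "[:0, 1:]"] by (simp add: t_def)
      have "\<zeta> (lin a b) \<le> absv b * t + absv a"
        using berk_A1_add[OF \<zeta>(1), of "[:0, b:]" "[:- a:]"] bX berk_A1_const[OF \<zeta>(1), of "- a"] by simp
      moreover have "absv b * t \<le> \<zeta> (lin a b) + absv a"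
        using berk_A1_add[OF \<zeta>(1), of "lin a b" "[:a:]"] bX berk_A1_const[OF \<zeta>(1), of a] by simp
      ultimately have "\<bar>\<zeta> (lin a b) - absv b * t\<bar> \<le> absv a"
        by linarith
      also have "absv a < e * t"
        using t e by (simp add: divide_less_eq mult.commute)
      finally have "\<bar>\<zeta> (lin a b) - absv b * t\<bar> / t < e"
        using t by (simp add: divide_less_eq)
      moreover have "\<zeta> (lin a b) / t - absv b = (\<zeta> (lin a b) - absv b * t) / t"
        using t by (simp add: field_simps)
      ultimately have "\<bar>\<zeta> (lin a b) / t - absv b\<bar> < e"
        using t by (simp add: abs_divide)
      then have "\<zeta> (lin a b) / t \<in> W"
        by (rule e)
      then show ?thesis
        using \<zeta> t by (simp add: V_def max_def flip: t_def)
    qed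
    then have "?S = Some ` V \<union> insert None (Some ` (berk_A1 absv - K))"
      unfolding S using True by auto
    moreover have "openin (berk_P1_top absv) (insert None (Some ` (berk_A1 absv - K)))"
      unfolding K_def by (intro openin_berk_P1_top_infinity compactin_berk_disc)
    ultimately show ?thesis
      using openin_Un[OF openin_berk_P1_top_basis[OF V]] by (simp only:)
  qed
qed

text \<open>Form norms detect the topology. Where \<open>Y\<close> does not vanish, dividing by a
  power of its norm recovers each evaluation; near infinity the norm of \<open>Y\<close> is small,
  while a compact set of finite points keeps it away from 0.\<close>

lemma continuous_map_into_berk_P1_top:
  assumes h: "h \<in> topspace X \<rightarrow> berk_P1 absv"
    and cont: "\<And>n p. degree p \<le> n \<Longrightarrow> continuous_map X euclideanreal (\<lambda>x. form_norm (h x) n p)"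
  shows "continuous_map X (berk_P1_top absv) h"
proof -
  define I where "I = {x \<in> topspace X. form_norm (h x) 1 [:1:] \<noteq> 0}"
  have "openin X {x \<in> topspace X. form_norm (h x) 1 [:1:] \<in> - {0}}"
    by (rule openin_continuous_map_preimage[OF cont]) auto
  then have I: "openin X I"
    by (simp add: I_def)
  have h_cases: "h x = None \<and> x \<notin> I \<or> (\<exists>\<zeta>. h x = Some \<zeta> \<and> \<zeta> \<in> berk_A1 absv \<and> x \<in> I)"
    if "x \<in> topspace X" for x
  proof -
    have "h x \<in> berk_P1 absv"
      using that h by auto
    then show ?thesis
      using that by (cases rule: berk_P1_cases) (auto simp: I_def form_norm_def berk_A1_const)
  qed
  have "continuous_map (subtopology X I) (berk_A1_top absv) (\<lambda>x. the (h x))"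
  proof (rule continuous_map_into_berk_A1_top)
    show "(\<lambda>x. the (h x)) \<in> topspace (subtopology X I) \<rightarrow> berk_A1 absv"
      using h_cases by fastforce
  next
    fix p
    have "continuous_map (subtopology X I) euclideanreal
        (\<lambda>x. form_norm (h x) (degree p) p / form_norm (h x) 1 [:1:] ^ degree p)"
      by (intro continuous_map_real_divide continuous_map_real_pow
          continuous_map_from_subtopology cont) (auto simp: I_def)
    moreover have "form_norm (h x) (degree p) p / form_norm (h x) 1 [:1:] ^ degree p = the (h x) p"
      if "x \<in> topspace (subtopology X I)" for x
      using that h_cases[of x] by (auto simp: form_norm_def berk_A1_const power_divide)
    ultimately show "continuous_map (subtopology X I) euclideanreal (\<lambda>x. the (h x) p)"
      by (rule continuous_map_eq)
  qed
  then have finite_part: "openin X {x \<in> topspace X. h x \<in> Some ` V}" if "openin (berk_A1_top absv) V" for V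
  proof -
    have "openin (subtopology X I) {x \<in> topspace (subtopology X I). the (h x) \<in> V}"
      using \<open>continuous_map (subtopology X I) _ _\<close> that by (rule openin_continuous_map_preimage)
    then have "openin X {x \<in> topspace (subtopology X I). the (h x) \<in> V}"
      using I openin_trans_full by blast
    moreover have "{x \<in> topspace (subtopology X I). the (h x) \<in> V} = {x \<in> topspace X. h x \<in> Some ` V}"
      using h_cases by fastforce
    ultimately show ?thesis
      by simp
  qed
  have infinite_part: "openin X {x \<in> topspace X. h x \<in> insert None (Some ` (berk_A1 absv - K))}"
    if K: "compactin (berk_A1_top absv) K" for K
  proof -
    \<comment> \<open>The coordinate is bounded on \<open>K\<close>, so the norm of \<open>Y\<close>
      is at least \<open>1 / M\<close> there.\<close>
    have "compact ((\<lambda>\<zeta>. \<zeta> [:0, 1:]) ` K)"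
      using image_compactin[OF K continuous_map_berk_A1_eval] by simp
    then obtain M0 where M0: "\<And>\<zeta>. \<zeta> \<in> K \<Longrightarrow> \<bar>\<zeta> [:0, 1:]\<bar> \<le> M0"
      by (force simp: bounded_real dest: compact_imp_bounded)
    define M where "M = max 1 M0"
    have M: "M \<ge> 1" "\<And>\<zeta>. \<zeta> \<in> K \<Longrightarrow> \<zeta> [:0, 1:] \<le> M"
      using M0 by (force simp: M_def)+
    have "openin (berk_A1_top absv) (topspace (berk_A1_top absv) - K)"
      using compactin_imp_closedin[OF Hausdorff_berk_A1_top K] by blast
    then have 1: "openin X {x \<in> topspace X. h x \<in> Some ` (berk_A1 absv - K)}"
      unfolding topspace_berk_A1_top by (rule finite_part)
    have 2: "openin X {x \<in> topspace X. form_norm (h x) 1 [:1:] \<in> {..<1 / M}}"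
      by (rule openin_continuous_map_preimage[OF cont]) auto
    have "h x \<in> insert None (Some ` (berk_A1 absv - K)) \<longleftrightarrow>
        h x \<in> Some ` (berk_A1 absv - K) \<or> form_norm (h x) 1 [:1:] \<in> {..<1 / M}"
      if "x \<in> topspace X" for x
    proof -
      have "\<zeta> \<notin> K" if "\<zeta> \<in> berk_A1 absv" "1 / max 1 (\<zeta> [:0, 1:]) < 1 / M" for \<zeta>
        using that M by (force simp: divide_less_cancel frac_less2 field_simps max_def split: if_splits)
      then show ?thesis
        using h_cases[OF that] M(1) by (auto simp: form_norm_def berk_A1_const)
    qed
    then have "{x \<in> topspace X. h x \<in> insert None (Some ` (berk_A1 absv - K))} =
        {x \<in> topspace X. h x \<in> Some ` (berk_A1 absv - K)} \<union>
        {x \<in> topspace X. form_norm (h x) 1 [:1:] \<in> {..<1 / M}}"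
      by blast
    then show ?thesis
      using openin_Un[OF 1 2] by (simp only:)
  qed
  show ?thesis
    unfolding berk_P1_top_def continuous_map_in_subtopology
  proof
    show "h \<in> topspace X \<rightarrow> berk_P1 absv"
      by (rule h)
    let ?B = "{Some ` V | V. openin (berk_A1_top absv) V} \<union>
         {insert None (Some ` (berk_A1 absv - K)) | K. compactin (berk_A1_top absv) K}"
    show "continuous_map X (topology_generated_by ?B) h"
    proof (rule continuous_on_generated_topo)
      fix U assume "U \<in> ?B"
      moreover have "h -` U \<inter> topspace X = {x \<in> topspace X. h x \<in> U}"
        by blast
      ultimately show "openin X (h -` U \<inter> topspace X)"
        using finite_part infinite_part by auto
    next
      \<comment> \<open>The choice \<open>K = {}\<close> makes the whole space a basic open
        set.\<close>
      have "berk_P1 absv \<in> ?B"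
        by (auto simp: berk_P1_def intro!: exI[of _ "{}"])
      then have "berk_P1 absv \<subseteq> \<Union> ?B"
        by (rule Union_upper)
      moreover have "h ` topspace X \<subseteq> berk_P1 absv"
        using h by auto
      ultimately show "h ` topspace X \<subseteq> \<Union> ?B"
        by (rule order_trans[rotated])
    qed
  qed
qed

end

section \<open>Factorization of forms\<close>

declare mult_pCons_left [simp del]

locale nonarch_closed = nonarch_field absv for absv :: "'a::field \<Rightarrow> real" +
  assumes alg_closed: "alg_closed_field TYPE('a)"
begin

lemma linear_factor:
  fixes p :: "'a poly"
  assumes "degree p = Suc n"
  obtains c q where "p = lin c 1 * q" "degree q = n" "q \<noteq> 0"
proof -
  have "0 < degree p"
    using assms by simp
  then obtain c where "poly p c = 0"
    using alg_closed unfolding alg_closed_field_def by blast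
  then obtain q where q: "p = lin c 1 * q"
    by (auto simp: poly_eq_0_iff_dvd)
  with assms have "q \<noteq> 0"
    by auto
  moreover from this have "degree p = Suc (degree q)"
    by (simp add: q degree_mult_eq)
  ultimately show thesis
    using q assms that by simp
qed

text \<open>Over an algebraically closed field a form is a constant times linear forms, each
  rescaled to norm 1. A root \<open>c\<close> outside the unit disc becomes
  \<open>[1 : 1/c]\<close>; a degree below the nominal one contributes factors \<open>Y\<close>,
  written \<open>lin (-1) 0\<close>.\<close>

lemma form_induct [consumes 1, case_names const mult]:
  assumes "degree p \<le> n"
    and const: "\<And>c. Q 0 [:c:]"
    and step: "\<And>n a b q. \<lbrakk>max (absv a) (absv b) = 1; degree q \<le> n; Q n q\<rbrakk> \<Longrightarrow> Q (Suc n) (lin a b * q)"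
  shows "Q n p"
  using assms(1)
proof (induction n arbitrary: p)
  case 0
  then show ?case
    by (metis const degree_eq_zeroE le_zero_eq)
next
  case (Suc n)
  show ?case
  proof (cases "degree p = Suc n")
    case True
    then obtain c q where p: "p = lin c 1 * q" and q: "degree q = n"
      by (rule linear_factor)
    show ?thesis
    proof (cases "absv c \<le> 1")
      case True
      then show ?thesis
        using step[of c 1 q n] Suc.IH[of q] p q by auto
    next
      case False
      then have c: "c \<noteq> 0"
        by auto
      have "lin c 1 = smult c (lin 1 (1 / c))"
        using c by simp
      then have "p = lin 1 (1 / c) * smult c q"
        by (simp only: p mult_smult_left mult_smult_right)
      then show ?thesis
        using step[of 1 "1 / c" "smult c q" n] Suc.IH[of "smult c q"] False q c
        by (auto simp: absv_divide divide_le_eq)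
    qed
  next
    case False
    then have "degree p \<le> n"
      using Suc.prems by simp
    then show ?thesis
      using step[of "-1" 0 p n] Suc.IH[of p] by (simp add: mult_pCons_left)
  qed
qed

lemma form_zero:
  assumes "degree p \<le> Suc n"
  obtains a b where "max (absv a) (absv b) = 1" "hom_eval (Suc n) p a b = 0"
proof -
  \<comment> \<open>The premise \<open>n = Suc m\<close> makes the constant case vacuous; the zero
    is that of the first linear factor.\<close>
  have "n = Suc m \<longrightarrow> (\<exists>a b. max (absv a) (absv b) = 1 \<and> hom_eval n p a b = 0)"
    if "degree p \<le> n" for n p m
    using that
  proof (induction rule: form_induct)
    case (mult n a b q)
    have "hom_eval (1 + n) (lin a b * q) a b = 0"
      by (subst hom_eval_mult) (use mult in \<open>auto simp: hom_eval_lin mult.commute\<close>)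
    then show ?case
      using mult by auto
  qed simp
  with assms that show thesis
    by blast
qed

text \<open>Cramer's rule: a unit determinant makes \<open>X\<close> and \<open>Y\<close> integral
  combinations of the two linear forms, so norms below 1 for both would contradict the scaling of
  the coordinates.\<close>

lemma form_norm_lin_eq_1:
  assumes z: "z \<in> berk_P1 absv"
    and le: "max (absv a) (absv b) \<le> 1" "max (absv c) (absv e) \<le> 1"
    and unit: "absv (e * a - c * b) = 1"
    and less: "form_norm z 1 (lin a b) < 1"
  shows "form_norm z 1 (lin c e) = 1"
proof (rule ccontr)
  assume "form_norm z 1 (lin c e) \<noteq> 1"
  moreover have "form_norm z 1 (lin c e) \<le> 1"
    using form_norm_le_gauss[OF z degree_lin, of c e] le unfolding gauss_lin by linarith
  ultimately have m: "form_norm z 1 (lin c e) < 1"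
    by simp
  have comb: "form_norm z 1 (smult x (lin c e) - smult y (lin a b)) < 1"
    if "absv x \<le> 1" "absv y \<le> 1" for x y
  proof -
    have "absv x * form_norm z 1 (lin c e) \<le> form_norm z 1 (lin c e)"
      "absv y * form_norm z 1 (lin a b) \<le> form_norm z 1 (lin a b)"
      using that form_norm_nonneg[OF z] by (auto intro: mult_left_le_one_le)
    then show ?thesis
      using form_norm_diff_le[OF z, of 1 "smult x (lin c e)" "smult y (lin a b)"] m less
      unfolding form_norm_smult[OF z] by linarith
  qed
  have eqs: "smult b (lin c e) - smult e (lin a b) = smult (e * a - c * b) [:1:]"
    "smult a (lin c e) - smult c (lin a b) = smult (e * a - c * b) [:0, 1:]"
    by (simp_all add: algebra_simps)
  have "form_norm z 1 (smult (e * a - c * b) [:1:]) < 1"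
    "form_norm z 1 (smult (e * a - c * b) [:0, 1:]) < 1"
    using comb[of b e] comb[of a c] le unfolding eqs by simp_all
  then have "form_norm z 1 [:1:] < 1" "form_norm z 1 [:0, 1:] < 1"
    unfolding form_norm_smult[OF z] unit by simp_all
  with max_form_norm_coordinates[OF z] show False
    by linarith
qed

text \<open>If the reduction does not vanish at \<open>[a:b]\<close>, no linear factor vanishes
  there modulo m, so each factor has norm 1 at every point \<open>z\<close> of that residue
  class.\<close>

lemma form_norm_eq_1:
  assumes "degree p \<le> n" and z: "z \<in> berk_P1 absv" and ab: "max (absv a) (absv b) = 1"
    and less: "form_norm z 1 (lin a b) < 1"
    and "gauss p = 1" "absv (hom_eval n p a b) = 1"
  shows "form_norm z n p = 1"
  using assms(1,5,6)
proof (induction rule: form_induct)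
  case (const c)
  then show ?case
    using z by (simp add: form_norm_const)
next
  case (mult n c e q)
  have q: "gauss q = 1"
    using mult by (simp add: gauss_norm_mult gauss_lin)
  have "hom_eval (1 + n) (lin c e * q) a b = hom_eval 1 (lin c e) a b * hom_eval n q a b"
    using mult by (intro hom_eval_mult) auto
  then have prod: "absv (e * a - c * b) * absv (hom_eval n q a b) = 1"
    using mult.prems by (simp add: hom_eval_lin absv_mult)
  have "absv (hom_eval n q a b) \<le> 1"
    using absv_hom_eval_le_gauss[of a b n q] ab q by linarith
  moreover have "absv (e * a - c * b) \<le> 1"
    using absv_hom_eval_le_gauss[of a b "Suc 0" "lin c e"] ab mult(1)
    unfolding hom_eval_lin gauss_lin by linarith
  ultimately have "absv (e * a - c * b) = 1" "absv (hom_eval n q a b) = 1"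
    using mult_eq_1_le_1D[OF prod] by auto
  then have "form_norm z 1 (lin c e) = 1" "form_norm z n q = 1"
    using form_norm_lin_eq_1[OF z, of a b c e] mult ab less q by auto
  then show ?case
    using form_norm_mult[OF z, of "lin c e" 1 q n] mult by simp
qed

text \<open>The value at \<open>[a:b]\<close> is a unit times the values of the normalized linear
  factors, so one of these vanishes modulo m; it is moved to the front.\<close>

lemma form_factor_at:
  assumes "degree p \<le> n" and ab: "max (absv a) (absv b) = 1"
    and "gauss p = 1" "absv (hom_eval n p a b) < 1"
  obtains m c e q where "n = Suc m" "degree q \<le> m" "gauss q = 1" "max (absv c) (absv e) = 1"
    "absv (e * a - c * b) < 1" "p = lin c e * q"
proof -
  have "\<exists>m c e q. n = Suc m \<and> degree q \<le> m \<and> gauss q = 1 \<and> max (absv c) (absv e) = 1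
      \<and> absv (e * a - c * b) < 1 \<and> p = lin c e * q"
    using assms(1,3,4)
  proof (induction rule: form_induct)
    case (const c)
    then show ?case
      by (simp add: hom_eval_const)
  next
    case (mult n c e q)
    have q: "gauss q = 1"
      using mult by (simp add: gauss_norm_mult gauss_lin)
    show ?case
    proof (cases "absv (e * a - c * b) < 1")
      case True
      then show ?thesis
        using mult q by blast
    next
      case False
      have "hom_eval (1 + n) (lin c e * q) a b = hom_eval 1 (lin c e) a b * hom_eval n q a b"
        using mult by (intro hom_eval_mult) auto
      then have "absv (e * a - c * b) * absv (hom_eval n q a b) < 1"
        using mult.prems by (simp add: hom_eval_lin absv_mult)
      moreover have "absv (hom_eval n q a b) \<le> absv (e * a - c * b) * absv (hom_eval n q a b)"
        using False mult_right_mono[of 1 "absv (e * a - c * b)" "absv (hom_eval n q a b)"] by simp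
      ultimately have "absv (hom_eval n q a b) < 1"
        by linarith
      then obtain m c' e' q' where *: "n = Suc m" "degree q' \<le> m" "gauss q' = 1"
        "max (absv c') (absv e') = 1" "absv (e' * a - c' * b) < 1" "q = lin c' e' * q'"
        using mult.IH q by blast
      have "degree (lin c e * q') \<le> n"
        using * degree_mult_le[of "lin c e" q'] degree_lin[of c e] by linarith
      moreover have "gauss (lin c e * q') = 1"
        using * mult by (simp add: gauss_norm_mult gauss_lin)
      moreover have "lin c e * q = lin c' e' * (lin c e * q')"
        using * by (simp only: ac_simps)
      ultimately show ?thesis
        using * by blast
    qed
  qed
  with that show thesis
    by blast
qed

text \<open>Over the residue field, a zero determinant makes the second vector a multiple of the
  first, which is nonzero; \<open>u\<close> is the quotient at a coordinate where the first is a
  unit.\<close>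

lemma proportional_mod_m:
  assumes "max (absv a) (absv b) = 1" "max (absv c) (absv e) \<le> 1" "absv (e * a - c * b) < 1"
  obtains u where "absv u \<le> 1" "absv (c - u * a) < 1" "absv (e - u * b) < 1"
proof (cases "absv b = 1")
  case True
  then have "b \<noteq> 0"
    by auto
  then have eq: "c - e / b * a = - ((e * a - c * b) / b)"
    by (simp add: field_simps)
  have "absv (c - e / b * a) < 1"
    unfolding eq absv_minus absv_divide using assms True by simp
  with assms True \<open>b \<noteq> 0\<close> show thesis
    by (intro that[of "e / b"]) (auto simp: absv_divide)
next
  case False
  then have a: "absv a = 1"
    using assms(1) by (auto simp: max_def split: if_splits)
  then have "a \<noteq> 0"
    by auto
  then have eq: "e - c / a * b = (e * a - c * b) / a"
    by (simp add: field_simps)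
  have "absv (e - c / a * b) < 1"
    unfolding eq absv_divide using assms a by simp
  with assms a \<open>a \<noteq> 0\<close> show thesis
    by (intro that[of "c / a"]) (auto simp: absv_divide)
qed

lemma lin_cong:
  assumes "max (absv a) (absv b) = 1" "max (absv c) (absv e) = 1" "absv (e * a - c * b) < 1"
  obtains u where "absv u \<le> 1" "gauss (lin c e - smult u (lin a b)) < 1"
proof -
  obtain u where "absv u \<le> 1" "absv (c - u * a) < 1" "absv (e - u * b) < 1"
    using proportional_mod_m[of a b c e] assms by auto
  moreover have "lin c e - smult u (lin a b) = lin (c - u * a) (e - u * b)"
    by simp
  ultimately show thesis
    using that[of u] by (simp only: gauss_lin max_less_iff_conj)
qed

text \<open>The factor theorem over the residue field, lifted: some linear factor of
  \<open>p\<close> has its root in the residue class of \<open>[a:b]\<close> and is congruent to a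
  multiple of \<open>lin a b\<close>. If \<open>p\<close> reduces to 0, the quotient 0
  serves.\<close>

lemma red_form_dvd_at_zero:
  assumes "degree p \<le> Suc n" "max (absv a) (absv b) = 1" "gauss p \<le> 1"
    "absv (hom_eval (Suc n) p a b) < 1"
  shows "red_form_dvd absv 1 (lin a b) (Suc n) p"
proof (cases "gauss p = 1")
  case False
  then show ?thesis
    using assms by (auto simp: red_form_dvd_def integral_poly_iff cong_m_iff intro!: exI[of _ 0])
next
  case True
  obtain m c e q where *: "Suc n = Suc m" "degree q \<le> m" "gauss q = 1"
    "max (absv c) (absv e) = 1" "absv (e * a - c * b) < 1" "p = lin c e * q"
    by (rule form_factor_at[OF assms(1,2) True assms(4)])
  obtain u where u: "absv u \<le> 1" "gauss (lin c e - smult u (lin a b)) < 1"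
    by (rule lin_cong[OF assms(2) *(4,5)])
  have "p - lin a b * smult u q = (lin c e - smult u (lin a b)) * q"
    unfolding *(6) by (simp only: left_diff_distrib mult_smult_left mult_smult_right)
  then have "gauss (p - lin a b * smult u q) = gauss (lin c e - smult u (lin a b)) * gauss q"
    by (simp only: gauss_norm_mult zero_less_one)
  then have "cong_m absv p (lin a b * smult u q)"
    using u * by (simp add: cong_m_iff)
  moreover have "integral_poly absv (smult u q)"
    using u * by (simp add: integral_poly_iff gauss_smult)
  moreover have "degree (smult u q) \<le> Suc n - 1"
    using * degree_smult_le[of u q] by simp
  ultimately show ?thesis
    unfolding red_form_dvd_def by (metis One_nat_def Suc_le_mono le0)
qed

lemma form_norm_eqI:
  assumes "degree p \<le> n" "z \<in> berk_P1 absv" "z' \<in> berk_P1 absv"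
    and "\<And>a b. max (absv a) (absv b) = 1 \<Longrightarrow> form_norm z 1 (lin a b) = form_norm z' 1 (lin a b)"
  shows "form_norm z n p = form_norm z' n p"
  using assms(1)
proof (induction rule: form_induct)
  case (const c)
  then show ?case
    using assms by (simp add: form_norm_const)
next
  case (mult n a b q)
  then show ?case
    using form_norm_mult[of _ "lin a b" 1 q n] assms by simp
qed

text \<open>The norm of \<open>Y\<close> vanishes only at infinity; at a finite point it determines
  the scaling factor, and then form norms give back all values of the seminorm.\<close>

lemma berk_P1_eqI:
  assumes "z \<in> berk_P1 absv" "z' \<in> berk_P1 absv"
    and "\<And>a b. max (absv a) (absv b) = 1 \<Longrightarrow> form_norm z 1 (lin a b) = form_norm z' 1 (lin a b)"
  shows "z = z'"
proof -
  have eq: "form_norm z n p = form_norm z' n p" if "degree p \<le> n" for n p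
    using form_norm_eqI[OF that assms] .
  have Y: "form_norm (Some \<zeta>) 1 [:1:] > 0" if "\<zeta> \<in> berk_A1 absv" for \<zeta>
    using that by (simp add: form_norm_def berk_A1_const)
  show ?thesis
    using assms(1)
  proof (cases z rule: berk_P1_cases)
    case None
    then have "form_norm z' 1 [:1:] = 0"
      using eq[of "[:1:]" 1] by (simp add: form_norm_None)
    with assms(2) None Y show ?thesis
      by (cases rule: berk_P1_cases) force+
  next
    case (Some \<zeta>)
    then have "form_norm z' 1 [:1:] > 0"
      using eq[of "[:1:]" 1] Y[of \<zeta>] by simp
    with assms(2) obtain \<zeta>' where \<zeta>': "z' = Some \<zeta>'" "\<zeta>' \<in> berk_A1 absv"
      by (cases rule: berk_P1_cases) (auto simp: form_norm_None)
    have N: "max 1 (\<zeta> [:0, 1:]) = max 1 (\<zeta>' [:0, 1:])"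
      using eq[of "[:1:]" 1] Some \<zeta>'
      by (simp add: form_norm_Some berk_A1_const field_simps max_def split: if_splits)
    have "max 1 (\<zeta>' [:0, 1:]) \<noteq> 0"
      by linarith
    then have "\<zeta> p = \<zeta>' p" for p
      using eq[of p "degree p"] Some \<zeta>' N by (simp add: form_norm_Some)
    then show ?thesis
      using Some \<zeta>' by auto
  qed
qed

lemma normalize_pair:
  assumes "a \<noteq> 0 \<or> b \<noteq> 0"
  obtains k a' b' where "k \<noteq> 0" "a = k * a'" "b = k * b'" "max (absv a') (absv b') = 1"
    "absv k = max (absv a) (absv b)"
proof (cases "absv a \<le> absv b")
  case True
  then have "b \<noteq> 0"
    using assms absv_pos_iff[of a] by (metis absv_0 not_le)
  then show thesis
    using True by (intro that[of b "a / b" 1]) (auto simp: absv_divide)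
next
  case False
  then have "a \<noteq> 0"
    by auto
  then show thesis
    using False by (intro that[of a 1 "b / a"]) (auto simp: absv_divide)
qed

end

section \<open>Maps of good reduction\<close>

lemma hom_comp_const: "hom_comp [:c:] f g = [:c:]"
  by (simp add: hom_comp_def)

text \<open>Clearing denominators is multiplicative because degrees add, which is where
  \<open>q \<noteq> 0\<close> enters.\<close>

lemma hom_comp_lin_mult:
  assumes "q \<noteq> 0"
  shows "hom_comp (lin c 1 * q) f g = (f - smult c g) * hom_comp q f g"
proof -
  define n where "n = degree q"
  have deg: "degree (lin c 1 * q) = Suc n"
    using assms by (simp add: degree_mult_eq n_def)
  have coeffs: "lin c 1 * q = pCons 0 q - smult c q"
    by (simp add: mult_pCons_left)
  have "hom_comp (lin c 1 * q) f g
      = (\<Sum>i\<le>Suc n. smult (coeff (pCons 0 q) i) (f ^ i * g ^ (Suc n - i)))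
        - (\<Sum>i\<le>Suc n. smult c (smult (coeff q i) (f ^ i * g ^ (Suc n - i))))"
    unfolding hom_comp_def deg sum_subtractf[symmetric]
    by (rule sum.cong) (simp_all add: coeffs smult_diff_left)
  also have "(\<Sum>i\<le>Suc n. smult (coeff (pCons 0 q) i) (f ^ i * g ^ (Suc n - i))) = f * hom_comp q f g"
    by (simp add: sum.atMost_Suc_shift hom_comp_def n_def sum_distrib_left mult_ac del: sum.atMost_Suc)
  \<comment> \<open>The term \<open>i = Suc n\<close> lies above the degree of \<open>q\<close> and
    vanishes; all others contain a factor \<open>g\<close>.\<close>
  also have "(\<Sum>i\<le>Suc n. smult c (smult (coeff q i) (f ^ i * g ^ (Suc n - i))))
      = (\<Sum>i\<le>n. smult c g * smult (coeff q i) (f ^ i * g ^ (n - i)))"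
    by (simp add: coeff_eq_0 n_def Suc_diff_le mult_ac)
  also have "\<dots> = smult c g * hom_comp q f g"
    by (simp add: hom_comp_def n_def sum_distrib_left)
  finally show ?thesis
    by (simp add: left_diff_distrib)
qed

lemma hom_comp_lin: "hom_comp (lin c 1) f g = f - smult c g"
  using hom_comp_lin_mult[of 1 c f g] hom_comp_const[of 1 f g] by (simp add: one_pCons)

context nonarch_closed
begin

text \<open>Splitting \<open>p\<close> into linear factors reduces invariance of a seminorm under
  the map to the polynomials \<open>lin c 1\<close>.\<close>

lemma berk_A1_hom_comp:
  assumes \<zeta>: "\<zeta> \<in> berk_A1 absv"
    and lin: "\<And>c. \<zeta> (f - smult c g) = \<zeta> (lin c 1) * \<zeta> g"
  shows "\<zeta> (hom_comp p f g) = \<zeta> p * \<zeta> g ^ degree p"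
proof (induction "degree p" arbitrary: p)
  case 0
  then obtain c where "p = [:c:]"
    by (metis degree_eq_zeroE)
  then show ?case
    by (simp add: hom_comp_const)
next
  case (Suc n)
  obtain c q where p: "p = lin c 1 * q" and q: "degree q = n" "q \<noteq> 0"
    using linear_factor Suc.hyps(2)[symmetric] .
  have "\<zeta> (hom_comp p f g) = \<zeta> (lin c 1) * \<zeta> g * (\<zeta> q * \<zeta> g ^ n)"
    using q by (simp add: p hom_comp_lin_mult berk_A1_mult[OF \<zeta>] lin Suc.hyps(1))
  then show ?case
    using Suc.hyps(2)[symmetric] by (simp add: p berk_A1_mult[OF \<zeta>])
qed

end

locale good_reduction_map = nonarch_closed absv for absv :: "'a::field \<Rightarrow> real" +
  fixes f g :: "'a poly"
  assumes rat_deg_ge_2: "2 \<le> rat_deg f g"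
    and normalized: "normalized absv f g"
    and good: "good_reduction absv f g"
begin

abbreviation d :: nat where
  "d \<equiv> rat_deg f g"

text \<open>The form \<open>l \<circ> (F, G)\<close> for \<open>l = b X - a Y\<close>.\<close>
definition pull :: "'a \<Rightarrow> 'a \<Rightarrow> 'a poly" where
  "pull a b = smult b f - smult a g"

lemma degree_f: "degree f \<le> d" and degree_g: "degree g \<le> d"
  by (simp_all add: rat_deg_def)

lemma degree_pull: "degree (pull a b) \<le> d"
  unfolding pull_def
  by (intro degree_diff_le order_trans[OF degree_smult_le] degree_f degree_g)

lemma gauss_f_le: "gauss f \<le> 1" and gauss_g_le: "gauss g \<le> 1"
  using normalized by (auto simp: normalized_def integral_poly_iff)

lemma gauss_f_or_g: "gauss f = 1 \<or> gauss g = 1"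
  using normalized integral_nonzero_red_iff by (auto simp: normalized_def)

lemma red_deg_eq: "red_deg absv f g = d"
  using good by (simp add: good_reduction_def)

text \<open>At a common zero of both reductions, \<open>lin a b\<close> would be a common factor of
  them, so the degree of the reduction would drop.\<close>

lemma reduced_values:
  assumes ab: "max (absv a) (absv b) = 1"
  shows "max (absv (hom_eval d f a b)) (absv (hom_eval d g a b)) = 1"
proof (rule ccontr)
  assume neq: "\<not> ?thesis"
  have "absv a \<le> 1" "absv b \<le> 1"
    using ab by auto
  then have "absv (hom_eval d f a b) \<le> 1" "absv (hom_eval d g a b) \<le> 1"
    using absv_hom_eval_le_gauss gauss_f_le gauss_g_le by (meson order_trans)+
  with neq have less: "absv (hom_eval d f a b) < 1" "absv (hom_eval d g a b) < 1"
    by linarith+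
  obtain n where n: "d = Suc n"
    using rat_deg_ge_2 by (cases d) auto
  \<comment> \<open>The predicate maximized in \<open>red_common_deg\<close>.\<close>
  define Q where "Q k \<longleftrightarrow> k \<le> d \<and>
     (\<exists>h. integral_poly absv h \<and> nonzero_red absv h \<and> degree h \<le> k \<and>
          red_form_dvd absv k h d f \<and> red_form_dvd absv k h d g)" for k
  have "red_form_dvd absv 1 (lin a b) d f" "red_form_dvd absv 1 (lin a b) d g"
    using red_form_dvd_at_zero[OF _ ab] less degree_f degree_g gauss_f_le gauss_g_le
    unfolding n by auto
  moreover have "integral_poly absv (lin a b)"
    using ab unfolding integral_poly_iff gauss_lin by simp
  moreover from this have "nonzero_red absv (lin a b)"
    using ab by (simp only: integral_nonzero_red_iff gauss_lin)
  ultimately have "Q 1"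
    using rat_deg_ge_2 degree_lin[of a b] unfolding Q_def by (metis Suc_1 Suc_leD One_nat_def)
  then have "1 \<le> red_common_deg absv f g"
    unfolding red_common_deg_def Q_def[symmetric]
    by (rule Greatest_le_nat[where b = d]) (simp add: Q_def)
  then show False
    using red_deg_eq rat_deg_ge_2 by (simp add: red_deg_def)
qed

text \<open>Otherwise one of the reductions of \<open>F\<close> and \<open>G\<close> would be a
  multiple of the other, and a zero of the latter would be a common zero, against
  \<open>reduced_values\<close>.\<close>

lemma gauss_pull:
  assumes ab: "max (absv a) (absv b) = 1"
  shows "gauss (pull a b) = 1"
proof (rule ccontr)
  assume neq: "\<not> ?thesis"
  have "absv a * gauss g \<le> 1" "absv b * gauss f \<le> 1"
    using ab gauss_f_le gauss_g_le by (auto intro!: mult_le_one)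
  then have "gauss (pull a b) \<le> 1"
    using gauss_diff_le[of "smult b f" "smult a g"] by (simp add: pull_def gauss_smult)
  with neq have less: "gauss (pull a b) < 1"
    by simp
  obtain n where n: "d = Suc n"
    using rat_deg_ge_2 by (cases d) auto
  have eval: "absv (b * hom_eval d f x y - a * hom_eval d g x y) < 1"
    if "max (absv x) (absv y) = 1" for x y
  proof -
    have "absv (hom_eval d (pull a b) x y) \<le> gauss (pull a b)"
      using that by (intro absv_hom_eval_le_gauss) auto
    then show ?thesis
      using less by (simp add: pull_def hom_eval_diff hom_eval_smult)
  qed
  consider "absv a = 1" | "absv b = 1"
    using ab by (auto simp: max_def split: if_splits)
  then show False
  proof cases
    case 1
    obtain x y where xy: "max (absv x) (absv y) = 1" "hom_eval d f x y = 0"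
      using form_zero[of f n] degree_f unfolding n by blast
    then show False
      using eval[OF xy(1)] reduced_values[OF xy(1)] 1 by (simp add: absv_mult)
  next
    case 2
    obtain x y where xy: "max (absv x) (absv y) = 1" "hom_eval d g x y = 0"
      using form_zero[of g n] degree_g unfolding n by blast
    then show False
      using eval[OF xy(1)] reduced_values[OF xy(1)] 2 by (simp add: absv_mult)
  qed
qed

text \<open>Either \<open>z\<close> lies in the residue class of some \<open>[a:b]\<close>, where
  one of the reductions does not vanish, or all normalized linear forms have norm 1 at
  \<open>z\<close>, so that form norms at \<open>z\<close> are Gauss norms.\<close>

lemma max_form_norm_f_g:
  assumes z: "z \<in> berk_P1 absv"
  shows "max (form_norm z d f) (form_norm z d g) = 1"
proof -
  have le: "form_norm z d f \<le> 1" "form_norm z d g \<le> 1"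
    using form_norm_le_gauss[OF z] degree_f degree_g gauss_f_le gauss_g_le by (meson order_trans)+
  have "form_norm z d f = 1 \<or> form_norm z d g = 1"
  proof (cases "\<exists>a b. max (absv a) (absv b) = 1 \<and> form_norm z 1 (lin a b) < 1")
    case True
    then obtain a b where ab: "max (absv a) (absv b) = 1" "form_norm z 1 (lin a b) < 1"
      by blast
    have one: "form_norm z d p = 1"
      if "degree p \<le> d" "gauss p \<le> 1" "absv (hom_eval d p a b) = 1" for p
    proof -
      have "absv (hom_eval d p a b) \<le> gauss p"
        using ab by (intro absv_hom_eval_le_gauss) auto
      then show ?thesis
        using form_norm_eq_1[OF that(1) z ab] that by simp
    qed
    have "absv (hom_eval d f a b) = 1 \<or> absv (hom_eval d g a b) = 1"
      using reduced_values[OF ab(1)] by linarith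
    then show ?thesis
      using one degree_f degree_g gauss_f_le gauss_g_le by blast
  next
    case False
    have "form_norm z 1 (lin a b) = form_norm (Some gauss) 1 (lin a b)"
      if "max (absv a) (absv b) = 1" for a b
      using False that form_norm_le_gauss[OF z degree_lin, of a b]
      unfolding form_norm_gauss gauss_lin by force
    then have "form_norm z n p = gauss p" if "degree p \<le> n" for n p
      using form_norm_eqI[OF that z gauss_in_berk_P1] by (simp add: form_norm_gauss)
    then show ?thesis
      using gauss_f_or_g degree_f degree_g by simp
  qed
  then show ?thesis
    using le by auto
qed

lemma form_norm_pull_all:
  assumes z: "z \<in> berk_P1 absv"
    and "\<And>a b. max (absv a) (absv b) = 1 \<Longrightarrow> form_norm z d (pull a b) = form_norm z 1 (lin a b)"
  shows "form_norm z d (pull a b) = form_norm z 1 (lin a b)"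
proof (cases "a = 0 \<and> b = 0")
  case True
  then show ?thesis
    using z by (simp add: pull_def form_norm_0)
next
  case False
  then obtain k a' b' where k: "a = k * a'" "b = k * b'" "max (absv a') (absv b') = 1"
    using normalize_pair by metis
  have "pull a b = smult k (pull a' b')" "lin a b = smult k (lin a' b')"
    by (simp_all add: k pull_def smult_diff_right)
  then show ?thesis
    by (simp only: form_norm_smult[OF z] assms(2)[OF k(3)])
qed

text \<open>By \<open>max_form_norm_f_g\<close> the lift \<open>(F, G)\<close> respects the scaling
  of the coordinates, so equality of points becomes equality of norms of linear forms without a
  further factor.\<close>

lemma berk_map_fixed_iff:
  assumes z: "z \<in> berk_P1 absv"
  shows "berk_map absv f g z = z \<longleftrightarrow>
    (\<forall>a b. max (absv a) (absv b) = 1 \<longrightarrow> form_norm z d (pull a b) = form_norm z 1 (lin a b))"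
    (is "?L \<longleftrightarrow> ?R")
proof -
  have R_all: "form_norm z d (pull a b) = form_norm z 1 (lin a b)" if ?R for a b
    using form_norm_pull_all[OF z] that by blast
  show ?thesis
    using z
  proof (cases z rule: berk_P1_cases)
    case None
    show ?thesis
    proof
      assume ?L
      then have less: "degree g < degree f"
        by (simp add: None berk_map_def split: if_splits)
      then have "coeff g d = 0"
        by (simp add: rat_deg_def coeff_eq_0)
      moreover from this have "absv (coeff f d) = 1"
        using max_form_norm_f_g[OF z] absv_nonneg[of "coeff f d"]
        by (simp add: None form_norm_None max_def split: if_splits)
      ultimately show ?R
        by (simp add: None form_norm_None pull_def absv_mult)
    next
      assume ?R
      then have "coeff g d = 0"
        using R_all[of 1 0] by (simp add: None form_norm_None pull_def)
      \<comment> \<open>If \<open>degree g = d\<close>, the vanishing top coefficient would give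
        \<open>g = 0\<close> and hence \<open>d = 0\<close>.\<close>
      then have "degree g \<noteq> d"
        using rat_deg_ge_2 by (metis degree_0 leading_coeff_0_iff not_numeral_le_zero)
      then have "degree g < degree f"
        by (auto simp: rat_deg_def max_def split: if_splits)
      then show ?L
        by (simp add: None berk_map_def)
    qed
  next
    case (Some \<zeta>)
    define N where "N = max 1 (\<zeta> [:0, 1:])"
    have N: "N > 0"
      by (simp add: N_def)
    have fn: "form_norm z n p = \<zeta> p / N ^ n" for n p
      by (simp add: Some form_norm_Some N_def)
    show ?thesis
    proof
      assume L: ?L
      then have g: "\<zeta> g \<noteq> 0"
        by (auto simp: Some berk_map_def)
      then have "(\<lambda>p. \<zeta> (hom_comp p f g) / \<zeta> g ^ degree p) = \<zeta>"
        using L by (simp add: Some berk_map_def)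
      then have "\<zeta> (hom_comp p f g) / \<zeta> g ^ degree p = \<zeta> p" for p
        by metis
      from this[of "lin _ 1"] have lin: "\<zeta> (f - smult c g) = \<zeta> (lin c 1) * \<zeta> g" for c
        using g by (simp add: hom_comp_lin field_simps)
      \<comment> \<open>Good reduction and fixedness give two expressions for this maximum;
        comparing them shows that \<open>G\<close> and \<open>Y\<close> have the same norm.\<close>
      have "max (\<zeta> f) (\<zeta> g) = N ^ d"
        using max_form_norm_f_g[OF z] N unfolding fn
        by (auto simp: max_def divide_simps split: if_splits)
      moreover have "max (\<zeta> f) (\<zeta> g) = \<zeta> g * N"
        using lin[of 0] berk_A1_nonneg[OF Some(2), of g]
        by (simp add: N_def max_mult_distrib_left max.commute mult.commute)
      ultimately have gN: "\<zeta> g * N = N ^ d"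
        by simp
      then have gN': "\<zeta> g / N ^ d = 1 / N"
        using N by (simp add: field_simps)
      show ?R
      proof (intro allI impI)
        fix a b assume ab: "max (absv a) (absv b) = 1"
        show "form_norm z d (pull a b) = form_norm z 1 (lin a b)"
        proof (cases "b = 0")
          case True
          have "pull a b = smult (- a) g" "lin a b = [:- a:]"
            using True by (simp_all add: pull_def)
          then have "form_norm z d (pull a b) = absv a * (\<zeta> g / N ^ d)"
            "form_norm z 1 (lin a b) = absv a * (1 / N)"
            using berk_A1_smult[OF Some(2), of "- a" g] berk_A1_const[OF Some(2), of "- a"]
            by (simp_all add: fn)
          then show ?thesis
            by (simp only: gN')
        next
          case False
          have eqs: "pull a b = smult b (f - smult (a / b) g)" "lin a b = smult b (lin (a / b) 1)"
            using False by (simp_all add: pull_def smult_diff_right)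
          have "\<zeta> (f - smult (a / b) g) / N ^ d = \<zeta> (lin (a / b) 1) / N"
            using gN' unfolding lin times_divide_eq_right[symmetric] by simp
          then show ?thesis
            unfolding eqs fn berk_A1_smult[OF Some(2)] by (simp flip: times_divide_eq_right)
        qed
      qed
    next
      assume ?R
      \<comment> \<open>The form \<open>-Y\<close> yields the norm of \<open>G\<close>, so
        \<open>g\<close> does not vanish at the point and the image is finite.\<close>
      have "\<zeta> (pull 1 0) / N ^ d = \<zeta> (lin 1 0) / N"
        using R_all[OF \<open>?R\<close>, of 1 0] by (simp add: fn)
      moreover have "\<zeta> (pull 1 0) = \<zeta> g" "\<zeta> (lin 1 0) = 1"
        using berk_A1_smult[OF Some(2), of "-1" g] berk_A1_const[OF Some(2), of "-1"]
        by (simp_all add: pull_def)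
      ultimately have g: "\<zeta> g / N ^ d = 1 / N"
        by simp
      then have g0: "\<zeta> g \<noteq> 0"
        using N by auto
      have "\<zeta> (f - smult c g) = \<zeta> (lin c 1) * \<zeta> g" for c
      proof -
        have "\<zeta> (f - smult c g) / N ^ d = \<zeta> (lin c 1) * (1 / N)"
          using R_all[OF \<open>?R\<close>, of c 1] by (simp add: fn pull_def)
        then show ?thesis
          using N by (simp flip: g)
      qed
      then have "\<zeta> (hom_comp p f g) = \<zeta> p * \<zeta> g ^ degree p" for p
        by (rule berk_A1_hom_comp[OF Some(2)])
      then show ?L
        using g0 by (simp add: Some berk_map_def)
    qed
  qed
qed

end

section \<open>Paths to the Gauss point\<close>

context nonarch_field
begin

lemma form_norm_disc:
  assumes r: "0 < r"
  shows "form_norm (Some (disc x r)) 1 (lin a b)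
    = max (absv (b * x - a)) (absv b * r) / max 1 (max (absv x) r)"
proof -
  have "pcompose (lin a b) [:x, 1:] = [:b * x - a, b:]"
    by (simp add: pcompose_pCons)
  then have "disc x r (lin a b) = max (absv (b * x - a)) (absv b * r)"
    using r by (simp only: disc_def gauss_norm_linear less_imp_le)
  moreover have "disc x r [:0, 1:] = max (absv x) r"
    using disc_linear[OF r, of x 0] by simp
  ultimately show ?thesis
    by (simp only: form_norm_Some power_one_right)
qed

text \<open>The disc of radius \<open>t\<close> around \<open>[c:e]\<close> in the spherical metric; the three cases are a disc
  inside the closed unit disc, a disc containing \<open>\<infinity>\<close>, and a disc in the residue class of \<open>\<infinity>\<close>
  avoiding \<open>\<infinity>\<close>.\<close>
lemma spherical_disc:
  assumes t: "0 < t" "t \<le> 1" and ce: "max (absv c) (absv e) = 1"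
  obtains z where "z \<in> berk_P1 absv"
    "\<And>a b. max (absv a) (absv b) = 1 \<Longrightarrow> form_norm z 1 (lin a b) = max (absv (b * c - a * e)) t"
proof -
  have disc_P1: "Some (disc x r) \<in> berk_P1 absv" if "0 < r" for x r
    using disc_in_berk_A1[OF that] by (simp add: berk_P1_def)
  have ultra: "absv (x - y) = absv x" if "absv y < absv x" for x y
    using absv_add_eq[of "- y" x] that by simp
  consider "absv e = 1" | "absv c = 1" "absv e \<le> t" | "absv c = 1" "t < absv e" "absv e < 1"
    using ce by linarith
  then show thesis
  proof cases
    case 1
    then have e: "e \<noteq> 0"
      by auto
    show thesis
    proof (rule that[OF disc_P1[OF t(1)]])
      fix a b assume ab: "max (absv a) (absv b) = 1"
      then have ab1: "absv a \<le> 1" "absv b \<le> 1"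
        by linarith+
      have ce_le: "absv (c / e) \<le> 1"
        using ce 1 by (simp add: absv_divide)
      have "b * c - a * e = (b * (c / e) - a) * e"
        using e by (simp add: field_simps)
      then have v: "absv (b * c - a * e) = absv (b * (c / e) - a)"
        using 1 by (simp add: absv_mult)
      have "max (absv (b * (c / e) - a)) (absv b * t) = max (absv (b * (c / e) - a)) t"
      proof (cases "absv b = 1")
        case False
        then have b: "absv b < 1" "absv a = 1"
          using ab by (auto simp: max_def split: if_splits)
        then have "absv (b * (c / e)) < absv a"
          using ce_le mult_left_le[of "absv (c / e)" "absv b"] unfolding absv_mult by simp
        then have "absv (b * (c / e) - a) = 1"
          using ultra[of "b * (c / e)" a] b by (simp add: absv_diff_commute)
        moreover have "absv b * t \<le> 1"
          using b t by (intro mult_le_one) auto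
        ultimately show ?thesis
          using t by simp
      qed simp
      moreover have "max 1 (max (absv (c / e)) t) = 1"
        using ce_le t by simp
      ultimately show "form_norm (Some (disc (c / e) t)) 1 (lin a b) = max (absv (b * c - a * e)) t"
        unfolding form_norm_disc[OF t(1)] v by simp
    qed
  next
    case 2
    \<comment> \<open>Here the spherical disc is the complement of the open disc of radius
      \<open>1 / t\<close> about 0; its point is that of the closed disc of this radius.\<close>
    have t': "0 < 1 / t"
      using t by simp
    show thesis
    proof (rule that[OF disc_P1[OF t']])
      fix a b assume ab: "max (absv a) (absv b) = 1"
      then have ab1: "absv a \<le> 1" "absv b \<le> 1"
        by linarith+
      have "max 1 (max (absv 0) (1 / t)) = 1 / t"
        using t by (simp add: max_def field_simps)
      then have fn: "form_norm (Some (disc 0 (1 / t))) 1 (lin a b) = max (absv a * t) (absv b)"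
        unfolding form_norm_disc[OF t'] using t by (simp add: max_def field_simps)
      show "form_norm (Some (disc 0 (1 / t))) 1 (lin a b) = max (absv (b * c - a * e)) t"
      proof (cases "t < absv b")
        case True
        have ae: "absv (a * e) \<le> t"
          using 2 ab1 mult_left_le[of "absv a" "absv e"] by (simp add: absv_mult mult.commute)
        then have "absv (a * e) < absv (b * c)"
          using True 2 by (simp add: absv_mult)
        then have "absv (b * c - a * e) = absv b"
          using ultra 2 by (simp add: absv_mult)
        moreover have "absv a * t \<le> t"
          using t ab1 mult_right_mono[of "absv a" 1 t] by simp
        ultimately show ?thesis
          unfolding fn using True by simp
      next
        case False
        have "absv (a * e) \<le> t"
          using 2 ab1 mult_left_le[of "absv a" "absv e"] by (simp add: absv_mult mult.commute)
        then have "absv (b * c - a * e) \<le> t"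
          using absv_diff_le[of "b * c" "a * e"] False 2 by (simp add: absv_mult)
        moreover have "max (absv a * t) (absv b) = t"
        proof (cases "absv a = 1")
          case False': False
          then have "absv b = 1"
            using ab by (auto simp: max_def split: if_splits)
          then have "t = 1"
            using False t by simp
          then show ?thesis
            using \<open>absv b = 1\<close> ab1 by simp
        qed (use False in simp)
        ultimately show ?thesis
          unfolding fn by simp
      qed
    qed
  next
    case 3
    define s where "s = absv e"
    have s: "0 < s" "s < 1" "t < s"
      using 3 t by (auto simp: s_def)
    then have e: "e \<noteq> 0"
      by (auto simp: s_def)
    \<comment> \<open>Near \<open>c / e\<close>, of absolute value \<open>1 / s\<close>, the
      spherical distance is \<open>s\<^sup>2\<close> times the affine one, hence this
      radius.\<close>
    have r: "0 < t / s\<^sup>2"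
      using s t by simp
    show thesis
    proof (rule that[OF disc_P1[OF r]])
      fix a b assume ab: "max (absv a) (absv b) = 1"
      then have ab1: "absv a \<le> 1" "absv b \<le> 1"
        by linarith+
      have "t / s\<^sup>2 \<le> 1 / s"
        using s by (simp add: power2_eq_square field_simps)
      then have N: "max 1 (max (absv (c / e)) (t / s\<^sup>2)) = 1 / s"
        using 3 s by (simp add: absv_divide s_def)
      have "b * (c / e) - a = (b * c - a * e) / e"
        using e by (simp add: field_simps)
      then have v: "absv (b * (c / e) - a) = absv (b * c - a * e) / s"
        by (simp add: absv_divide s_def)
      have "max (absv (b * c - a * e) / s) (absv b * (t / s\<^sup>2)) / (1 / s)
          = max (absv (b * c - a * e) / s * s) (absv b * (t / s\<^sup>2) * s)"
        using s by (simp add: max_mult_distrib_right)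
      then have fn: "form_norm (Some (disc (c / e) (t / s\<^sup>2))) 1 (lin a b)
          = max (absv (b * c - a * e)) (absv b * t / s)"
        unfolding form_norm_disc[OF r] N v using s by (simp add: power2_eq_square)
      have bc: "absv (b * c) = absv b"
        using 3 by (simp add: absv_mult)
      consider "absv b = s" | "s < absv b" | "absv b < s"
        by linarith
      then show "form_norm (Some (disc (c / e) (t / s\<^sup>2))) 1 (lin a b) = max (absv (b * c - a * e)) t"
      proof cases
        case 1
        then show ?thesis
          unfolding fn using s by simp
      next
        case 2
        have "absv (a * e) \<le> s"
          using ab1 mult_left_le[of "absv a" s] s by (simp add: absv_mult s_def mult.commute)
        then have "absv (b * c - a * e) = absv b"
          using ultra[of "a * e" "b * c"] bc 2 by simp
        moreover have "absv b * t / s \<le> absv b"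
          using s by (simp add: divide_le_eq mult_left_mono)
        ultimately show ?thesis
          unfolding fn using 2 s by simp
      next
        case less: 3
        then have a: "absv a = 1"
          using ab s by (auto simp: max_def split: if_splits)
        then have ae: "absv (a * e) = s"
          by (simp add: absv_mult s_def)
        have "absv (b * c - a * e) = s"
          using ultra[of "b * c" "a * e"] bc ae less absv_diff_commute[of "b * c" "a * e"] by simp
        moreover have "absv b * t / s \<le> t"
          using s t less by (simp add: divide_le_eq mult.commute mult_left_mono)
        ultimately show ?thesis
          unfolding fn using s by simp
      qed
    qed
  qed
qed

text \<open>By Cramer's identities the determinant times \<open>X\<close> and times \<open>Y\<close>
  are integral combinations of the two forms, and conversely \<open>e\<close> and \<open>c\<close>
  times \<open>lin a b\<close> are expressed through them; one of \<open>c\<close>, \<open>e\<close>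
  is a unit. So from radius \<open>t\<close> on, \<open>z\<close> is indistinguishable from
  \<open>[c:e]\<close>.\<close>

lemma max_form_norm_lin:
  assumes z: "z \<in> berk_P1 absv" and ce: "max (absv c) (absv e) = 1" and ab: "max (absv a) (absv b) = 1"
    and le: "form_norm z 1 (lin c e) \<le> t"
  shows "max (form_norm z 1 (lin a b)) t = max (absv (b * c - a * e)) t"
proof -
  define v where "v = b * c - a * e"
  define M where "M = max (form_norm z 1 (lin a b)) t"
  have nn: "0 \<le> form_norm z 1 p" for p
    by (rule form_norm_nonneg[OF z])
  have le1: "absv a \<le> 1" "absv b \<le> 1" "absv c \<le> 1" "absv e \<le> 1"
    using ab ce by linarith+
  have scale: "absv x * form_norm z 1 p \<le> form_norm z 1 p" if "absv x \<le> 1" for x p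
    using mult_right_mono[OF that nn[of p]] by simp
  have eqs: "smult v [:1:] = smult e (lin a b) - smult b (lin c e)"
    "smult v [:0, 1:] = smult c (lin a b) - smult a (lin c e)"
    by (simp_all add: v_def algebra_simps)
  have "absv v * form_norm z 1 [:1:] \<le> M" "absv v * form_norm z 1 [:0, 1:] \<le> M"
    unfolding form_norm_smult[OF z, symmetric] eqs M_def
    using form_norm_diff_le[OF z, of 1 "smult e (lin a b)" "smult b (lin c e)"]
      form_norm_diff_le[OF z, of 1 "smult c (lin a b)" "smult a (lin c e)"]
      scale[of e "lin a b"] scale[of b "lin c e"] scale[of c "lin a b"] scale[of a "lin c e"] le le1
    unfolding form_norm_smult[OF z] by linarith+
  then have v_le: "absv v \<le> M"
    using max_form_norm_coordinates[OF z] by (auto simp: max_def split: if_splits)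
  have "smult e (lin a b) = smult b (lin c e) + smult v [:1:]"
    "smult c (lin a b) = smult a (lin c e) + smult v [:0, 1:]"
    by (simp_all add: v_def algebra_simps)
  then have "form_norm z 1 (smult e (lin a b)) \<le> max (form_norm z 1 (smult b (lin c e))) (form_norm z 1 (smult v [:1:]))"
    "form_norm z 1 (smult c (lin a b)) \<le> max (form_norm z 1 (smult a (lin c e))) (form_norm z 1 (smult v [:0, 1:]))"
    using form_norm_add_le[OF z] by metis+
  moreover have "absv v * form_norm z 1 [:1:] \<le> absv v" "absv v * form_norm z 1 [:0, 1:] \<le> absv v"
    using max_form_norm_coordinates[OF z] by (auto intro!: mult_left_le)
  ultimately have "absv e * form_norm z 1 (lin a b) \<le> max t (absv v)"
    "absv c * form_norm z 1 (lin a b) \<le> max t (absv v)"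
    using scale[OF le1(2), of "lin c e"] scale[OF le1(1), of "lin c e"] le
    unfolding form_norm_smult[OF z] by linarith+
  moreover have "absv c = 1 \<or> absv e = 1"
    using ce by (auto simp: max_def split: if_splits)
  ultimately have "form_norm z 1 (lin a b) \<le> max t (absv v)"
    by auto
  with v_le show ?thesis
    unfolding M_def v_def by linarith
qed

text \<open>If some normalized form has norm below \<open>t\<close>, the spherical disc of radius
  \<open>t\<close> about its zero gives the point; otherwise all values are at least
  \<open>t\<close> already and \<open>z\<close> itself serves.\<close>

lemma path_point_exists:
  assumes z: "z \<in> berk_P1 absv" and t: "0 \<le> t" "t \<le> 1"
  shows "\<exists>z' \<in> berk_P1 absv. \<forall>a b. max (absv a) (absv b) = 1 \<longrightarrow>
    form_norm z' 1 (lin a b) = max (form_norm z 1 (lin a b)) t"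
proof (cases "\<exists>c e. max (absv c) (absv e) = 1 \<and> form_norm z 1 (lin c e) < t")
  case True
  then obtain c e where ce: "max (absv c) (absv e) = 1" "form_norm z 1 (lin c e) < t"
    by blast
  then have "0 < t"
    using form_norm_nonneg[OF z, of 1 "lin c e"] by linarith
  then obtain z' where "z' \<in> berk_P1 absv"
    "\<And>a b. max (absv a) (absv b) = 1 \<Longrightarrow> form_norm z' 1 (lin a b) = max (absv (b * c - a * e)) t"
    using spherical_disc[OF _ t(2) ce(1)] by blast
  then show ?thesis
    using max_form_norm_lin[OF z ce(1)] ce(2) by (intro bexI[of _ z']) auto
next
  case False
  then show ?thesis
    using z by (intro bexI[of _ z]) (auto simp: not_less max_def intro: antisym)
qed

text \<open>Specified by its values on linear forms, because the centre of the disc may depend on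
  \<open>t\<close>. Over an algebraically closed field \<open>berk_P1_eqI\<close> makes the point
  unique.\<close>

definition path_point :: "('a poly \<Rightarrow> real) option \<Rightarrow> real \<Rightarrow> ('a poly \<Rightarrow> real) option" where
  "path_point z t = (SOME z'. z' \<in> berk_P1 absv \<and> (\<forall>a b. max (absv a) (absv b) = 1 \<longrightarrow>
    form_norm z' 1 (lin a b) = max (form_norm z 1 (lin a b)) t))"

lemma
  assumes "z \<in> berk_P1 absv" "0 \<le> t" "t \<le> 1"
  shows path_point_in_berk_P1: "path_point z t \<in> berk_P1 absv"
    and form_norm_path_point: "max (absv a) (absv b) = 1 \<Longrightarrow>
      form_norm (path_point z t) 1 (lin a b) = max (form_norm z 1 (lin a b)) t"
  using someI_ex[OF path_point_exists[OF assms, unfolded Bex_def]]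
  unfolding path_point_def[symmetric] by blast+

end

context nonarch_closed
begin

lemma path_point_0: "z \<in> berk_P1 absv \<Longrightarrow> path_point z 0 = z"
  by (rule berk_P1_eqI)
    (simp_all only: path_point_in_berk_P1 form_norm_path_point form_norm_nonneg max_absorb1
      order_refl zero_le_one)

lemma path_point_1:
  assumes z: "z \<in> berk_P1 absv"
  shows "path_point z 1 = Some gauss"
proof (rule berk_P1_eqI)
  fix a b assume ab: "max (absv a) (absv b) = 1"
  have "form_norm z 1 (lin a b) \<le> 1"
    using form_norm_le_gauss[OF z degree_lin, of a b] ab unfolding gauss_lin by simp
  then show "form_norm (path_point z 1) 1 (lin a b) = form_norm (Some gauss) 1 (lin a b)"
    unfolding form_norm_gauss gauss_lin ab form_norm_path_point[OF z zero_le_one order_refl ab]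
    by simp
qed (simp_all add: path_point_in_berk_P1 z gauss_in_berk_P1)

text \<open>Norms of linear factors only grow along the path. Together with
  \<open>form_norm_le_gauss\<close> this keeps a form of Gauss norm 1 at norm 1 once it has that
  value.\<close>

lemma form_norm_path_point_mono:
  assumes "degree p \<le> n" and z: "z \<in> berk_P1 absv" and t: "0 \<le> t" "t \<le> 1"
  shows "form_norm z n p \<le> form_norm (path_point z t) n p"
  using assms(1)
proof (induction rule: form_induct)
  case (const c)
  then show ?case
    by (simp add: form_norm_const z path_point_in_berk_P1 t)
next
  case (mult n a b q)
  have z': "path_point z t \<in> berk_P1 absv"
    by (rule path_point_in_berk_P1[OF z t])
  have "form_norm z (1 + n) (lin a b * q) = form_norm z 1 (lin a b) * form_norm z n q"
    using mult by (intro form_norm_mult[OF z]) auto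
  also have "\<dots> \<le> form_norm (path_point z t) 1 (lin a b) * form_norm (path_point z t) n q"
    using mult t form_norm_path_point[OF z t mult(1)] form_norm_nonneg[OF z] form_norm_nonneg[OF z']
    by (intro mult_mono) auto
  also have "\<dots> = form_norm (path_point z t) (1 + n) (lin a b * q)"
    using mult by (intro form_norm_mult[OF z', symmetric]) auto
  finally show ?case
    by simp
qed

text \<open>On a linear factor the norm is the maximum of a constant and \<open>t\<close>; form
  norms are products of such functions and a constant.\<close>

lemma continuous_map_path_point:
  assumes z: "z \<in> berk_P1 absv"
  shows "continuous_map (top_of_set {0..1}) (berk_P1_top absv) (path_point z)"
proof (rule continuous_map_into_berk_P1_top)
  show "path_point z \<in> topspace (top_of_set {0..1}) \<rightarrow> berk_P1 absv"
    using path_point_in_berk_P1[OF z] by auto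
next
  fix n and p :: "'a poly" assume "degree p \<le> n"
  then have "continuous_on {0..1} (\<lambda>t. form_norm (path_point z t) n p)"
  proof (induction rule: form_induct)
    case (const c)
    have "form_norm (path_point z t) 0 [:c:] = absv c" if "t \<in> {0..1}" for t
      using that z by (simp add: form_norm_const path_point_in_berk_P1)
    then show ?case
      by (intro continuous_on_eq[OF continuous_on_const[of _ "absv c"]]) simp
  next
    case (mult n a b q)
    have eq: "form_norm (path_point z t) (Suc n) (lin a b * q)
        = max (form_norm z 1 (lin a b)) t * form_norm (path_point z t) n q" if "t \<in> {0..1}" for t
      using that form_norm_mult[OF path_point_in_berk_P1[OF z], of t "lin a b" 1 q n] mult
        form_norm_path_point[OF z _ _ mult(1), of t] by simp
    have "continuous_on {0..1}
        (\<lambda>t. max (form_norm z 1 (lin a b)) t * form_norm (path_point z t) n q)"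
      using mult.IH by (intro continuous_intros)
    then show ?case
      by (rule continuous_on_eq) (rule eq[symmetric])
  qed
  then show "continuous_map (top_of_set {0..1}) euclideanreal (\<lambda>t. form_norm (path_point z t) n p)"
    by simp
qed

end

section \<open>The fixed point locus\<close>

context good_reduction_map
begin

lemma fixed_locus_iff:
  "z \<in> berk_fixed_locus absv f g \<longleftrightarrow> z \<in> berk_P1 absv \<and>
    (\<forall>a b. max (absv a) (absv b) = 1 \<longrightarrow> form_norm z d (pull a b) = form_norm z 1 (lin a b))"
  using berk_map_fixed_iff by (auto simp: berk_fixed_locus_def)

lemma gauss_point_fixed: "Some gauss \<in> berk_fixed_locus absv f g"
  unfolding fixed_locus_iff form_norm_gauss gauss_lin
  using gauss_in_berk_P1 gauss_pull by simp

section \<open>Fixed critical points of the reduction and connectedness\<close>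

lemma hom_eval_pull: "hom_eval d (pull a b) x y = b * hom_eval d f x y - a * hom_eval d g x y"
  by (simp add: pull_def hom_eval_diff hom_eval_smult)

text \<open>Two linear factors in one residue class give the reduction of \<open>pull a b\<close> a
  double zero. As the reduced map fixes \<open>[a:b]\<close>, the pair \<open>(C, E)\<close> is
  congruent to \<open>u\<close> times \<open>(a, b)\<close>, so \<open>smult E f - smult C g\<close>
  is congruent to \<open>u\<close> times \<open>pull a b\<close> and inherits the square
  factor.\<close>

lemma red_has_fixed_critI:
  assumes ab: "max (absv a) (absv b) = 1"
    and eval: "absv (hom_eval d (pull a b) a b) < 1"
    and m: "max (absv c) (absv e) = 1" "absv (e * a - c * b) < 1"
    and m': "max (absv c') (absv e') = 1" "absv (e' * a - c' * b) < 1"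
    and q: "gauss q = 1" "degree q \<le> d - 2"
    and pull: "pull a b = lin c e * (lin c' e' * q)"
  shows "red_has_fixed_crit absv f g"
proof -
  define l where "l = lin a b"
  define C where "C = hom_eval d f a b"
  define E where "E = hom_eval d g a b"
  have ab1: "absv a \<le> 1" "absv b \<le> 1"
    using ab by auto
  have CE: "max (absv C) (absv E) = 1"
    unfolding C_def E_def by (rule reduced_values[OF ab])
  have bCaE: "absv (b * C - a * E) < 1"
    using eval by (simp add: hom_eval_pull C_def E_def)
  obtain u where u: "absv u \<le> 1" "absv (C - u * a) < 1" "absv (E - u * b) < 1"
    using proportional_mod_m[OF ab, of C E] CE bCaE by (auto simp: absv_diff_commute mult.commute)
  obtain v where v: "absv v \<le> 1" "gauss (lin c e - smult v l) < 1"
    unfolding l_def by (rule lin_cong[OF ab m])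
  obtain w where w: "absv w \<le> 1" "gauss (lin c' e' - smult w l) < 1"
    unfolding l_def by (rule lin_cong[OF ab m'])
  have l: "gauss l = 1" "gauss (lin c' e') = 1"
    using ab m' by (simp_all only: l_def gauss_lin)
  have "gauss (pull a b - l ^ 2 * smult (v * w) q) < 1"
  proof -
    \<comment> \<open>The two factors are replaced by multiples of \<open>l\<close> one after the
      other.\<close>
    have "p * (p' * q) - l ^ 2 * smult (v * w) q
        = (p - smult v l) * (p' * q) + (p' - smult w l) * (smult v l * q)" for p p'
      by (simp add: power2_eq_square algebra_simps smult_diff_right)
    then have "pull a b - l ^ 2 * smult (v * w) q = (lin c e - smult v l) * (lin c' e' * q)
        + (lin c' e' - smult w l) * (smult v l * q)"
      unfolding pull .
    moreover have "gauss (lin c' e' * q) \<le> 1" "gauss (smult v l * q) \<le> 1"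
      using l q v by (simp_all only: gauss_norm_mult gauss_smult zero_less_one mult_1_right order_refl)
    ultimately show ?thesis
      using v w by (simp only: gauss_add_less gauss_mult_less)
  qed
  then have 1: "gauss (smult u (pull a b - l ^ 2 * smult (v * w) q)) < 1"
    using u by (intro gauss_smult_le_less)
  have "gauss (smult (E - u * b) f - smult (C - u * a) g) < 1"
    using u gauss_f_le gauss_g_le by (intro gauss_diff_less gauss_smult_less)
  moreover have "smult E f - smult C g - l ^ 2 * smult (u * v * w) q
      = (smult (E - u * b) f - smult (C - u * a) g) + smult u (pull a b - l ^ 2 * smult (v * w) q)"
    by (simp add: pull_def smult_diff_right smult_diff_left mult.assoc)
  ultimately have "cong_m absv (smult E f - smult C g) (l ^ 2 * smult (u * v * w) q)"
    unfolding cong_m_iff using 1 by (simp only: gauss_add_less)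
  moreover have "integral_poly absv (smult (u * v * w) q)"
    using u v w q by (auto simp: integral_poly_iff gauss_smult absv_mult intro!: mult_le_one)
  moreover have "degree (smult (u * v * w) q) \<le> d - 2"
    using q degree_smult_le order_trans by blast
  ultimately have "red_form_dvd absv 2 (l ^ 2) d (smult E f - smult C g)"
    using rat_deg_ge_2 unfolding red_form_dvd_def by blast
  then have "red_fixed_critical absv d f g a b"
    using CE bCaE rat_deg_ge_2 unfolding red_fixed_critical_def Let_def C_def E_def l_def by auto
  \<comment> \<open>Under good reduction the common factor can be taken as 1, so \<open>f\<close>
    and \<open>g\<close> themselves represent the reduced map.\<close>
  moreover have "integral_poly absv 1" "nonzero_red absv 1"
    using integral_nonzero_red_iff[of 1] gauss_norm_const[of 1 1] integral_poly_iff[of 1]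
    by (simp_all add: one_pCons)
  moreover have "integral_poly absv f" "integral_poly absv g"
    using gauss_f_le gauss_g_le by (simp_all add: integral_poly_iff)
  moreover have "cong_m absv f (1 * f)" "cong_m absv g (1 * g)"
    by (simp_all add: cong_m_iff)
  ultimately show ?thesis
    unfolding red_has_fixed_crit_def red_deg_eq Let_def
    using ab ab1 degree_f degree_g by (metis degree_1 le0)
qed

lemma path_point_fixed:
  assumes ncrit: "\<not> red_has_fixed_crit absv f g"
    and fixed: "z \<in> berk_fixed_locus absv f g" and t: "0 \<le> t" "t \<le> 1"
  shows "path_point z t \<in> berk_fixed_locus absv f g"
proof -
  have z: "z \<in> berk_P1 absv"
    using fixed by (simp add: fixed_locus_iff)
  have eq: "form_norm z d (pull a b) = form_norm z 1 (lin a b)"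
      if "max (absv a) (absv b) = 1" for a b
    using fixed that by (auto simp: fixed_locus_iff)
  define y where "y = path_point z t"
  have y: "y \<in> berk_P1 absv"
    unfolding y_def by (rule path_point_in_berk_P1[OF z t])
  have y_lin: "form_norm y 1 (lin a b) = max (form_norm z 1 (lin a b)) t"
    if "max (absv a) (absv b) = 1" for a b
    unfolding y_def by (rule form_norm_path_point[OF z t that])
  have y_one: "form_norm y n p = 1" if "degree p \<le> n" "gauss p = 1" "form_norm z n p = 1" for n p
    using form_norm_path_point_mono[OF that(1) z t] form_norm_le_gauss[OF y that(1)] that
    by (simp add: y_def)
  have "form_norm y d (pull a b) = form_norm y 1 (lin a b)" if ab: "max (absv a) (absv b) = 1" for a b
  proof (cases "form_norm z 1 (lin a b) < 1")
    case False
    moreover have "form_norm z 1 (lin a b) \<le> 1"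
      using form_norm_le_gauss[OF z degree_lin, of a b] ab unfolding gauss_lin by simp
    ultimately have "form_norm z 1 (lin a b) = 1"
      by simp
    then show ?thesis
      using y_one[OF degree_pull gauss_pull[OF ab]] eq[OF ab] y_lin[OF ab] t by simp
  next
    case True
    \<comment> \<open>Otherwise \<open>pull a b\<close> would have norm 1 at \<open>z\<close>, while
      \<open>z\<close> is fixed and \<open>lin a b\<close> has norm below 1.\<close>
    have eval: "absv (hom_eval d (pull a b) a b) < 1"
    proof (rule ccontr)
      assume "\<not> ?thesis"
      moreover have "absv (hom_eval d (pull a b) a b) \<le> 1"
        using absv_hom_eval_le_gauss[of a b d "pull a b"] gauss_pull[OF ab] ab by linarith
      ultimately have "form_norm z d (pull a b) = 1"
        using form_norm_eq_1[OF degree_pull z ab True gauss_pull[OF ab]] by simp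
      then show False
        using eq[OF ab] True by simp
    qed
    obtain n c e q where q: "d = Suc n" "degree q \<le> n" "gauss q = 1" "max (absv c) (absv e) = 1"
      "absv (e * a - c * b) < 1" "pull a b = lin c e * q"
      by (rule form_factor_at[OF degree_pull ab gauss_pull[OF ab] eval])
    \<comment> \<open>A second factor vanishing in this residue class would make the fixed point
      critical.\<close>
    have "absv (hom_eval n q a b) = 1"
    proof (rule ccontr)
      assume "\<not> ?thesis"
      moreover have "absv (hom_eval n q a b) \<le> 1"
        using absv_hom_eval_le_gauss[of a b n q] q(3) ab by linarith
      ultimately have less: "absv (hom_eval n q a b) < 1"
        by simp
      obtain n' c' e' q' where q': "n = Suc n'" "degree q' \<le> n'" "gauss q' = 1"
        "max (absv c') (absv e') = 1" "absv (e' * a - c' * b) < 1" "q = lin c' e' * q'"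
        by (rule form_factor_at[OF q(2) ab q(3) less])
      have "red_has_fixed_crit absv f g"
        using red_has_fixed_critI[OF ab eval q(4,5) q'(4,5,3)] q q' by simp
      with ncrit show False
        by blast
    qed
    then have q1: "form_norm z n q = 1"
      by (rule form_norm_eq_1[OF q(2) z ab True q(3)])
    have pull_eq: "form_norm x d (pull a b) = form_norm x 1 (lin c e) * form_norm x n q"
      if "x \<in> berk_P1 absv" for x
      using form_norm_mult[OF that degree_lin q(2), of c e] q(1,6) by simp
    \<comment> \<open>The two linear forms have equal norm at \<open>z\<close>, hence also after
      taking the maximum with \<open>t\<close>.\<close>
    have "form_norm z 1 (lin c e) = form_norm z 1 (lin a b)"
      using pull_eq[OF z] eq[OF ab] q1 by simp
    then show ?thesis
      using pull_eq[OF y] y_one[OF q(2,3) q1] y_lin[OF ab] y_lin[OF q(4)] by simp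
  qed
  with y show ?thesis
    by (simp add: fixed_locus_iff y_def)
qed

text \<open>The path of each fixed point stays in the locus and ends at the Gauss point, so the
  locus is a union of connected sets with a common point.\<close>

lemma connectedin_fixed_locus:
  assumes ncrit: "\<not> red_has_fixed_crit absv f g"
  shows "connectedin (berk_P1_top absv) (berk_fixed_locus absv f g)"
proof -
  let ?F = "berk_fixed_locus absv f g"
  let ?P = "\<lambda>z. path_point z ` {0..1}"
  have P1: "z \<in> berk_P1 absv" if "z \<in> ?F" for z
    using that by (simp add: fixed_locus_iff)
  have "connectedin (berk_P1_top absv) (?P z)" if "z \<in> ?F" for z
    by (rule connectedin_continuous_map_image[OF continuous_map_path_point[OF P1[OF that]]])
      (simp add: connectedin_subtopology)
  moreover have "Some gauss \<in> ?P z" if "z \<in> ?F" for z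
    using path_point_1[OF P1[OF that]] by (intro image_eqI[of _ _ 1]) auto
  then have "\<Inter> (?P ` ?F) \<noteq> {}"
    by blast
  ultimately have "connectedin (berk_P1_top absv) (\<Union> (?P ` ?F))"
    by (intro connectedin_Union) blast+
  moreover have "\<Union> (?P ` ?F) = ?F"
  proof
    show "\<Union> (?P ` ?F) \<subseteq> ?F"
      using path_point_fixed[OF ncrit] by auto
    show "?F \<subseteq> \<Union> (?P ` ?F)"
    proof
      fix z assume z: "z \<in> ?F"
      then have "z \<in> ?P z"
        using path_point_0[OF P1[OF z]] by (intro image_eqI[of _ _ 0]) auto
      with z show "z \<in> \<Union> (?P ` ?F)"
        by blast
    qed
  qed
  ultimately show ?thesis
    by simp
qed

text \<open>Good reduction forces the common factor \<open>h\<close> to be a unit constant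
  \<open>h0\<close>. Modulo m the pair \<open>(c, e)\<close> is a unit multiple of
  \<open>(a, b)\<close>, so the square factor of \<open>smult e f' - smult c g'\<close> passes to
  \<open>pull a b\<close>.\<close>

lemma red_has_fixed_critD:
  assumes "red_has_fixed_crit absv f g"
  obtains a b Q where "max (absv a) (absv b) = 1" "gauss Q \<le> 1" "degree Q \<le> d - 2"
    "gauss (pull a b - lin a b ^ 2 * Q) < 1"
proof -
  obtain h f' g' a b where h: "integral_poly absv h" "nonzero_red absv h" "degree h \<le> d - d"
    and fg': "integral_poly absv f'" "integral_poly absv g'"
    and cong: "cong_m absv f (h * f')" "cong_m absv g (h * g')"
    and ab: "max (absv a) (absv b) = 1"
    and crit: "red_fixed_critical absv d f' g' a b"
    using assms unfolding red_has_fixed_crit_def red_deg_eq Let_def by blast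
  define c where "c = hom_eval d f' a b"
  define e where "e = hom_eval d g' a b"
  have ab1: "absv a \<le> 1" "absv b \<le> 1"
    using ab by auto
  obtain h0 where h0: "h = [:h0:]"
    using h(3) by (metis degree_eq_zeroE diff_self_eq_0 le_zero_eq)
  have h01: "absv h0 = 1"
    using h(1,2) integral_nonzero_red_iff[OF h(1)] by (simp add: h0)
  have f'g': "gauss f' \<le> 1" "gauss g' \<le> 1"
    using fg' by (simp_all add: integral_poly_iff)
  have ce: "\<not> (absv c < 1 \<and> absv e < 1)" "absv (b * c - a * e) < 1"
    and dvd: "red_form_dvd absv 2 (lin a b ^ 2) d (smult e f' - smult c g')"
    using crit by (auto simp: red_fixed_critical_def Let_def c_def e_def)
  obtain Q where Q: "gauss Q \<le> 1" "degree Q \<le> d - 2"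
    "gauss (smult e f' - smult c g' - lin a b ^ 2 * Q) < 1"
    using dvd by (auto simp: red_form_dvd_def integral_poly_iff cong_m_iff)
  have "absv c \<le> 1" "absv e \<le> 1"
    using absv_hom_eval_le_gauss[OF ab1] f'g' unfolding c_def e_def by (meson order_trans)+
  then obtain u where u: "absv u \<le> 1" "absv (c - u * a) < 1" "absv (e - u * b) < 1"
    using proportional_mod_m[OF ab, of c e] ce(2) by (auto simp: absv_diff_commute mult.commute)
  \<comment> \<open>Otherwise \<open>c\<close> and \<open>e\<close> would both vanish modulo m and
    would not represent a point.\<close>
  have "absv u = 1"
  proof (rule ccontr)
    assume "absv u \<noteq> 1"
    then have "absv u < 1"
      using u by simp
    then have "absv (u * a) < 1" "absv (u * b) < 1"
      using ab1 mult_left_le[of "absv a" "absv u"] mult_left_le[of "absv b" "absv u"]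
      by (simp_all add: absv_mult)
    then have "absv c < 1" "absv e < 1"
      using absv_add_le[of "c - u * a" "u * a"] absv_add_le[of "e - u * b" "u * b"] u
      by simp_all
    then show False
      using ce by blast
  qed
  then have u0: "u \<noteq> 0" and hu: "absv (h0 / u) = 1"
    using h01 by (auto simp: absv_divide)
  have "gauss (smult (u * b - e) f' - smult (u * a - c) g') < 1"
    using u f'g' by (intro gauss_diff_less gauss_smult_less) (simp_all add: absv_diff_commute)
  moreover have "gauss (smult b (f - smult h0 f') - smult a (g - smult h0 g')) < 1"
    using cong ab1 unfolding cong_m_iff h0
    by (intro gauss_diff_less[OF gauss_smult_le_less gauss_smult_le_less])
      (simp_all add: mult_pCons_left)
  \<comment> \<open>First \<open>f\<close>, \<open>g\<close> are replaced by \<open>h0\<close> times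
    \<open>f'\<close>, \<open>g'\<close>, then \<open>(a, b)\<close> by \<open>(c, e)\<close>
    divided by \<open>u\<close>.\<close>
  moreover have "pull a b - lin a b ^ 2 * smult (h0 / u) Q
      = (smult b (f - smult h0 f') - smult a (g - smult h0 g'))
        + smult (h0 / u) ((smult (u * b - e) f' - smult (u * a - c) g')
          + (smult e f' - smult c g' - lin a b ^ 2 * Q))"
    using u0 by (simp add: pull_def smult_diff_right smult_diff_left smult_add_right mult_ac)
  ultimately have "gauss (pull a b - lin a b ^ 2 * smult (h0 / u) Q) < 1"
    using Q(3) hu by (simp only: gauss_add_less gauss_smult_le_less order_refl)
  moreover have "gauss (smult (h0 / u) Q) \<le> 1"
    using Q hu by (simp add: gauss_smult)
  moreover have "degree (smult (h0 / u) Q) \<le> d - 2"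
    using Q degree_smult_le order_trans by blast
  ultimately show thesis
    using that ab by blast
qed

text \<open>The zeros of the form \<open>Y F - X G\<close> are the fixed points of the map on \<open>\<P>\<^sup>1(L)\<close>.\<close>
lemma gauss_fixed_point_form: "gauss (lin (-1) 0 * f - lin 0 1 * g) = 1"
proof (rule ccontr)
  define H where "H = lin (-1) 0 * f - lin 0 1 * g"
  have H: "H = f - [:0, 1:] * g"
    by (simp add: H_def mult_pCons_left)
  assume neq: "gauss (lin (-1) 0 * f - lin 0 1 * g) \<noteq> 1"
  have X: "gauss [:0, 1:] = 1"
    by (simp add: gauss_norm_linear)
  have "gauss H \<le> 1"
    using gauss_diff_le[of f "[:0, 1:] * g"] gauss_f_le gauss_g_le
    by (simp add: H gauss_norm_mult X)
  then have less: "gauss H < 1"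
    using neq by (simp add: H_def)
  \<comment> \<open>If \<open>Y F\<close> and \<open>X G\<close> agreed modulo m, the top
    coefficient \<open>c\<close> of \<open>G\<close> would vanish there, giving
    \<open>G = Y K\<close> and \<open>F = X K\<close> modulo m; a zero of \<open>K\<close> would be
    a common zero of the reductions.\<close>
  define c where "c = coeff g d"
  define K where "K = g - monom c d"
  have "coeff H (Suc d) = - c"
    using degree_f by (simp add: H c_def mult_pCons_left coeff_eq_0)
  then have c: "absv c < 1"
    using coeff_le_gauss[of H "Suc d"] less by simp
  \<comment> \<open>\<open>K\<close> is a form of degree \<open>d - 1\<close>, which is positive, so
    it has a zero.\<close>
  have "d = Suc (Suc (d - 2))"
    using rat_deg_ge_2 by simp
  then obtain n where n: "d = Suc (Suc n)" ..
  have K: "degree K \<le> Suc n"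
  proof (rule degree_le, intro allI impI)
    fix i assume "Suc n < i"
    then show "coeff K i = 0"
      using degree_g n by (cases "i = d") (auto simp: K_def c_def coeff_eq_0)
  qed
  obtain x y where xy: "max (absv x) (absv y) = 1" "hom_eval (Suc n) K x y = 0"
    by (rule form_zero[OF K])
  have xy1: "absv x \<le> 1" "absv y \<le> 1"
    using xy by auto
  have zero: "hom_eval d (lin a b * K) x y = 0" for a b
    using hom_eval_mult[OF degree_lin K, of a b x y] xy(2) by (simp add: n)
  have "g = lin (-1) 0 * K + monom c d"
    by (simp add: K_def mult_pCons_left)
  then have "hom_eval d g x y = hom_eval d (monom c d) x y"
    using zero[of "-1" 0] hom_eval_add[of d "lin (-1) 0 * K" "monom c d" x y] by simp
  then have "absv (hom_eval d g x y) < 1"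
    using absv_hom_eval_le_gauss[OF xy1, of d "monom c d"] c by simp
  moreover have f_eq: "lin 0 1 * K + (H + [:0, 1:] * monom c d) = f"
    by (simp add: H K_def right_diff_distrib)
  have "hom_eval d f x y = hom_eval d (H + [:0, 1:] * monom c d) x y"
    using hom_eval_add[of d "lin 0 1 * K" "H + [:0, 1:] * monom c d" x y]
    unfolding zero f_eq by simp
  then have "absv (hom_eval d f x y) \<le> gauss (H + [:0, 1:] * monom c d)"
    using absv_hom_eval_le_gauss[OF xy1] by simp
  moreover have "gauss (H + [:0, 1:] * monom c d) < 1"
    using less c by (intro gauss_add_less) (simp_all add: gauss_norm_mult X)
  ultimately show False
    using reduced_values[OF xy(1)] by simp
qed

text \<open>The form \<open>Y F - X G\<close> has Gauss norm 1 and vanishes modulo m at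
  \<open>[a:b]\<close>, so one of its linear factors has its zero \<open>[c:e]\<close> in that
  residue class; this zero is a classical fixed point.\<close>

lemma fixed_point_in_residue_disc:
  assumes ab: "max (absv a) (absv b) = 1" and eval: "absv (hom_eval d (pull a b) a b) < 1"
  obtains z where "z \<in> berk_fixed_locus absv f g" "form_norm z 1 (lin a b) < 1"
proof -
  define H where "H = lin (-1) 0 * f - lin 0 1 * g"
  have deg: "degree (lin s t * p) \<le> Suc d" if "degree p \<le> d" for s t p
    using degree_mult_le[of "lin s t" p] degree_lin[of s t] that by linarith
  have degH: "degree H \<le> Suc d"
    unfolding H_def by (intro degree_diff_le deg degree_f degree_g)
  have H_eval: "hom_eval (Suc d) H x y = y * hom_eval d f x y - x * hom_eval d g x y" for x y
    using hom_eval_mult[OF degree_lin degree_f, of "-1" 0 x y]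
      hom_eval_mult[OF degree_lin degree_g, of 0 1 x y]
    by (simp add: H_def hom_eval_diff hom_eval_def[of "Suc 0"])
  have "absv (hom_eval (Suc d) H a b) < 1"
    using eval by (simp add: H_eval hom_eval_pull)
  then obtain m c e q where q: "Suc d = Suc m" "degree q \<le> m" "max (absv c) (absv e) = 1"
    "absv (e * a - c * b) < 1" "H = lin c e * q"
    using form_factor_at[OF degH ab] gauss_fixed_point_form unfolding H_def by metis
  define C where "C = hom_eval d f c e"
  define E where "E = hom_eval d g c e"
  have "hom_eval (Suc d) H c e = 0"
    using hom_eval_mult[OF degree_lin q(2), of c e c e] q(1) by (simp add: q(5) hom_eval_lin mult.commute)
  then have eC: "e * C = c * E"
    by (simp add: H_eval C_def E_def)
  obtain k where k: "C = k * c" "E = k * e"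
  proof (cases "e = 0")
    case True
    then have "c \<noteq> 0"
      using q(3) by auto
    then show ?thesis
      using that[of "C / c"] eC True by simp
  next
    case False
    then show ?thesis
      using that[of "E / e"] eC by (simp add: field_simps)
  qed
  \<comment> \<open>Good reduction makes the factor \<open>k\<close> a unit, so the fixed point
    keeps its norms without rescaling.\<close>
  have "max (absv C) (absv E) = absv k * max (absv c) (absv e)"
    by (simp add: k absv_mult max_mult_distrib_left)
  then have k1: "absv k = 1"
    using reduced_values[OF q(3)] q(3) by (simp add: C_def E_def)
  define z where "z = classical_point c e"
  have fn: "form_norm z n p = absv (hom_eval n p c e)" if "degree p \<le> n" for n p
    unfolding z_def by (rule form_norm_classical_point[OF q(3) that])
  have lin: "form_norm z 1 (lin x y) = absv (y * c - x * e)" for x y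
    unfolding fn[OF degree_lin] by (simp add: hom_eval_lin)
  have "form_norm z d (pull x y) = form_norm z 1 (lin x y)" for x y
  proof -
    have "form_norm z d (pull x y) = absv (y * C - x * E)"
      unfolding fn[OF degree_pull] hom_eval_pull C_def E_def ..
    also have "y * C - x * E = k * (y * c - x * e)"
      by (simp add: k algebra_simps)
    finally show ?thesis
      unfolding lin by (simp add: absv_mult k1)
  qed
  then have "z \<in> berk_fixed_locus absv f g"
    unfolding fixed_locus_iff by (simp add: z_def classical_point_in_berk_P1)
  moreover have "form_norm z 1 (lin a b) < 1"
    unfolding lin using q(4) by (simp add: absv_diff_commute mult.commute)
  ultimately show thesis
    by (rule that)
qed

lemma not_connectedin_fixed_locus:
  assumes "red_has_fixed_crit absv f g"
  shows "\<not> connectedin (berk_P1_top absv) (berk_fixed_locus absv f g)"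
proof -
  let ?F = "berk_fixed_locus absv f g"
  obtain a b Q where ab: "max (absv a) (absv b) = 1" and Q: "gauss Q \<le> 1" "degree Q \<le> d - 2"
    and cong: "gauss (pull a b - lin a b ^ 2 * Q) < 1"
    by (rule red_has_fixed_critD[OF assms])
  define \<rho> where "\<rho> = gauss (pull a b - lin a b ^ 2 * Q)"
  have deg2: "degree (lin a b ^ 2) \<le> 2"
    using degree_power_le[of "lin a b" 2] degree_lin[of a b] by linarith
  have d: "d = 2 + (d - 2)"
    using rat_deg_ge_2 by simp
  have deg: "degree (pull a b - lin a b ^ 2 * Q) \<le> d"
    using degree_mult_le[of "lin a b ^ 2" Q] deg2 Q d
    by (intro degree_diff_le degree_pull) linarith
  \<comment> \<open>The square factor vanishes at \<open>[a:b]\<close>, so \<open>pull a b\<close>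
    vanishes there modulo m and the residue class is fixed.\<close>
  have "hom_eval 2 (lin a b ^ 2) a b = 0"
    using hom_eval_mult[OF degree_lin degree_lin, of a b a b a b]
    unfolding one_add_one power2_eq_square[symmetric] by (simp add: hom_eval_lin mult.commute)
  then have "hom_eval d (lin a b ^ 2 * Q) a b = 0"
    using hom_eval_mult[OF deg2 Q(2), of a b] d by simp
  then have "hom_eval d (pull a b) a b = hom_eval d (pull a b - lin a b ^ 2 * Q) a b"
    by (simp add: hom_eval_diff)
  moreover have "absv (hom_eval d (pull a b - lin a b ^ 2 * Q) a b) \<le> \<rho>"
    unfolding \<rho>_def using ab by (intro absv_hom_eval_le_gauss) auto
  ultimately have "absv (hom_eval d (pull a b) a b) < 1"
    using cong by (simp add: \<rho>_def)
  then obtain z where z: "z \<in> ?F" "form_norm z 1 (lin a b) < 1"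
    by (rule fixed_point_in_residue_disc[OF ab])
  \<comment> \<open>Fixedness gives \<open>s \<le> max \<rho> (s ^ 2)\<close>, and for
    \<open>s\<close> below 1 the square reaches \<open>s\<close> only at
    \<open>s = 0\<close>.\<close>
  have gap: "form_norm y 1 (lin a b) \<le> \<rho>" if y: "y \<in> ?F" "form_norm y 1 (lin a b) < 1" for y
  proof -
    define s where "s = form_norm y 1 (lin a b)"
    have yP: "y \<in> berk_P1 absv"
      using y by (simp add: fixed_locus_iff)
    have s: "0 \<le> s" "s < 1"
      using y form_norm_nonneg[OF yP] by (simp_all add: s_def)
    have "form_norm y 2 (lin a b ^ 2) = s ^ 2"
      using form_norm_mult[OF yP degree_lin degree_lin, of a b a b]
      unfolding one_add_one s_def power2_eq_square .
    then have "form_norm y d (lin a b ^ 2 * Q) = s ^ 2 * form_norm y (d - 2) Q"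
      using form_norm_mult[OF yP deg2 Q(2)] d by simp
    also have "\<dots> \<le> s ^ 2 * 1"
      using form_norm_le_gauss[OF yP Q(2)] Q(1) by (intro mult_left_mono) auto
    finally have sq: "form_norm y d (lin a b ^ 2 * Q) \<le> s ^ 2"
      by simp
    have "s = form_norm y d ((pull a b - lin a b ^ 2 * Q) + lin a b ^ 2 * Q)"
      using y ab by (simp add: fixed_locus_iff s_def)
    also have "\<dots> \<le> max \<rho> (s ^ 2)"
      using form_norm_add_le[OF yP, of d "pull a b - lin a b ^ 2 * Q" "lin a b ^ 2 * Q"]
        form_norm_le_gauss[OF yP deg] sq unfolding \<rho>_def by linarith
    finally have "s \<le> \<rho> \<or> s \<le> s * s"
      by (simp add: le_max_iff_disj power2_eq_square)
    moreover have "s = 0" if "s \<le> s * s"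
    proof (rule ccontr)
      assume "s \<noteq> 0"
      with s have "s * s < s * 1"
        by (intro mult_strict_left_mono) auto
      with that show False
        by linarith
    qed
    moreover have "0 \<le> \<rho>"
      by (simp add: \<rho>_def)
    ultimately show ?thesis
      unfolding s_def[symmetric] by linarith
  qed
  have gauss_pt: "form_norm (Some gauss) 1 (lin a b) = 1"
    using ab by (simp only: form_norm_gauss gauss_lin)
  \<comment> \<open>On the fixed locus the gap makes these two open conditions
    complementary.\<close>
  define U where "U = {z \<in> berk_P1 absv. form_norm z 1 (lin a b) \<in> {..<1}}"
  define V where "V = {z \<in> berk_P1 absv. form_norm z 1 (lin a b) \<in> {\<rho><..}}"
  have "openin (berk_P1_top absv) U" "openin (berk_P1_top absv) V"
    unfolding U_def V_def by (intro openin_form_norm_lin; simp)+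
  moreover have "?F \<subseteq> U \<union> V"
    using cong by (auto simp: U_def V_def fixed_locus_iff \<rho>_def)
  moreover have "U \<inter> V \<inter> ?F = {}"
    using gap by (force simp: U_def V_def)
  moreover have "U \<inter> ?F \<noteq> {}"
    using z by (auto simp: U_def fixed_locus_iff)
  moreover have "V \<inter> ?F \<noteq> {}"
    using gauss_point_fixed gauss_pt cong gauss_in_berk_P1 by (auto simp: V_def \<rho>_def)
  ultimately show ?thesis
    unfolding connectedin by blast
qed

end

theorem theorem3p2:
  fixes absv :: "'a::field_char_0 \<Rightarrow> real" and f g :: "'a poly"
  assumes "nonarch_abs absv" and "complete_abs absv" and "alg_closed_field TYPE('a)"
    and "coprime f g" and "2 \<le> rat_deg f g"
    and "normalized absv f g"
    and "good_reduction absv f g"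
  shows "connectedin (berk_P1_top absv) (berk_fixed_locus absv f g)
           \<longleftrightarrow> \<not> red_has_fixed_crit absv f g"
proof -
  interpret good_reduction_map absv f g
    by unfold_locales (use assms in auto)
  show ?thesis
    using connectedin_fixed_locus not_connectedin_fixed_locus by blast
qed

end
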